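(* Let $\gamma_\star\approx 1.37184$ be the threshold defined in the context and let $\gamma>\gamma_\star$. Consider any continuous family of unidirectional Stokes waves, or of unidirectional solitary waves, with constant adverse (dimensionless) vorticity $\omega=-\gamma$, connected to a laminar flow. Then every wave of the family satisfies $$u(x,\eta(x))\ \ge\ \tfrac12\,\gamma\,\eta(x)\qquad\text{for all } x\in\mathbb{R},$$ i.e. $u\ge\frac12\gamma\eta$ on the surface $y=\eta(x)$. In particular, extreme waves (with a stagnation point on the surface) or overhanging waves (whose surface is no longer a graph) cannot form along such a family before a stagnation point has emerged on the bottom.
   Context: Setting (non-dimensional steady water waves with relative mass flux and gravity both equal to $1$, constant vorticity $\omega=v_x-u_y=-\gamma<0$). A solution consists of a smooth surface profile $\eta:\mathbb{R}\to(0,\infty)$, a stream function $\psi$ smooth up to the boundary of $D=\{(x,y):x\in\mathbb{R},\ 0<y<\eta(x)\}$, and a Bernoulli constant $r\in\mathbb{R}$, with $\Delta\psi=\gamma$ in $D$; $\frac12|\nabla\psi|^2+y=r$ on $y=\eta(x)$; $\psi=1$ on $y=\eta(x)$; $\psi=0$ on $y=0$. The relative velocity is $(u,v)=(\psi_y,-\psi_x)$. The solution is unidirectional if $u=\psi_y>0$ everywhere in the fluid (including its boundary). A stagnation point is a point where $(u,v)=(0,0)$. A Stokes wave is a solution periodic in $x$ whose profile $\eta$ has exactly one crest and one trough in each minimal period. A solitary wave is a non-laminar solution converging uniformly to a flat background (laminar) state as $|x|\to\infty$; unidirectional solitary waves are known to be waves of elevation with exactly one crest. Waves are translated so that a crest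 is at $x=0$. Write $\hat\eta=\sup_x\eta(x)$ and $\hat u=\psi_y(0,\hat\eta)$. A laminar flow is a solution with horizontal velocity and flat surface; the unidirectional ones are $\psi=\Psi(y;s)=\frac12\gamma y^2+sy$, $\eta=d(s)$, $r=R(s)$ with $s>0$, where $d(s)=\dfrac{-s+\sqrt{s^2+2\gamma}}{\gamma}$ and $R(s)=\frac12s^2+\gamma+d(s)$. The function $R$ has a unique critical point $s_c=s_c(\gamma)>0$ (its minimum), i.e. $s_c-\frac1\gamma+\frac{s_c}{\gamma\sqrt{s_c^2+2\gamma}}=0$. The threshold $\gamma_\star\approx1.37184$ is the unique $\gamma>0$ with $R(s_c(\gamma))=\frac{\gamma}{2}+\frac{2}{\sqrt\gamma}$. A continuous family connected to a laminar flow is a continuous one-parameter family of solutions, $\gamma$ being fixed, parametrized by $t\in[0,T)$, whose member at $t=0$ is a unidirectional laminar flow ($s>0$) and whose members for $t>0$ are waves of the stated type; in particular $r$, $\hat\eta$ and $\hat u$ depend continuously on $t$ (the period of Stokes waves may vary). *)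

theory Defs
  imports "HOL-Analysis.Analysis"
begin

text \<open>
  All derivatives are taken within a region \<open>S\<close> of the plane, so that they also make sense at
  boundary points of \<open>S\<close>.
\<close>

definition pdx :: "(real \<times> real) set \<Rightarrow> (real \<times> real \<Rightarrow> real) \<Rightarrow> real \<times> real \<Rightarrow> real" where
  "pdx S f z = frechet_derivative f (at z within S) (1, 0)"

definition pdy :: "(real \<times> real) set \<Rightarrow> (real \<times> real \<Rightarrow> real) \<Rightarrow> real \<times> real \<Rightarrow> real" where
  "pdy S f z = frechet_derivative f (at z within S) (0, 1)"

definition laplacian :: "(real \<times> real) set \<Rightarrow> (real \<times> real \<Rightarrow> real) \<Rightarrow> real \<times> real \<Rightarrow> real" where
  "laplacian S f z = pdx S (pdx S f) z + pdy S (pdy S f) z"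

definition velocity ::
  "(real \<times> real) set \<Rightarrow> (real \<times> real \<Rightarrow> real) \<Rightarrow> real \<times> real \<Rightarrow> real \<times> real" where
  "velocity S \<psi> z = (pdy S \<psi> z, - pdx S \<psi> z)"

text \<open>\<open>P i j\<close> is the partial derivative of \<open>f\<close> of order \<open>i\<close> in \<open>x\<close> and \<open>j\<close> in \<open>y\<close>.\<close>

definition smooth_on :: "(real \<times> real) set \<Rightarrow> (real \<times> real \<Rightarrow> real) \<Rightarrow> bool" where
  "smooth_on S f \<longleftrightarrow>
     (\<exists>P :: nat \<Rightarrow> nat \<Rightarrow> real \<times> real \<Rightarrow> real.
        P 0 0 = f \<and>
        (\<forall>i j. \<forall>z\<in>S.
           (P i j has_derivative (\<lambda>(h, k). P (Suc i) j z * h + P i (Suc j) z * k))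
             (at z within S)))"

definition smooth_real :: "(real \<Rightarrow> real) \<Rightarrow> bool" where
  "smooth_real f \<longleftrightarrow> (\<forall>k x. (deriv ^^ k) f differentiable (at x))"

definition fluid :: "(real \<Rightarrow> real) \<Rightarrow> (real \<times> real) set" where
  "fluid \<eta> = {(x, y). 0 < y \<and> y < \<eta> x}"

definition closed_fluid :: "(real \<Rightarrow> real) \<Rightarrow> (real \<times> real) set" where
  "closed_fluid \<eta> = {(x, y). 0 \<le> y \<and> y \<le> \<eta> x}"

definition wave_solution ::
  "real \<Rightarrow> (real \<Rightarrow> real) \<Rightarrow> (real \<times> real \<Rightarrow> real) \<Rightarrow> real \<Rightarrow> bool" where
  "wave_solution \<gamma> \<eta> \<psi> r \<longleftrightarrow>
     (\<forall>x. 0 < \<eta> x) \<and>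
     smooth_real \<eta> \<and>
     smooth_on (closed_fluid \<eta>) \<psi> \<and>
     (\<forall>z\<in>fluid \<eta>. laplacian (closed_fluid \<eta>) \<psi> z = \<gamma>) \<and>
     (\<forall>x. ((pdx (closed_fluid \<eta>) \<psi> (x, \<eta> x))\<^sup>2 + (pdy (closed_fluid \<eta>) \<psi> (x, \<eta> x))\<^sup>2) / 2
            + \<eta> x = r) \<and>
     (\<forall>x. \<psi> (x, \<eta> x) = 1) \<and>
     (\<forall>x. \<psi> (x, 0) = 0)"

definition unidirectional :: "(real \<Rightarrow> real) \<Rightarrow> (real \<times> real \<Rightarrow> real) \<Rightarrow> bool" where
  "unidirectional \<eta> \<psi> \<longleftrightarrow> (\<forall>z\<in>closed_fluid \<eta>. 0 < fst (velocity (closed_fluid \<eta>) \<psi> z))"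

definition laminar ::
  "real \<Rightarrow> (real \<Rightarrow> real) \<Rightarrow> (real \<times> real \<Rightarrow> real) \<Rightarrow> real \<Rightarrow> bool" where
  "laminar \<gamma> \<eta> \<psi> r \<longleftrightarrow>
     wave_solution \<gamma> \<eta> \<psi> r \<and>
     (\<exists>d. \<forall>x. \<eta> x = d) \<and>
     (\<forall>z\<in>closed_fluid \<eta>. snd (velocity (closed_fluid \<eta>) \<psi> z) = 0)"

definition lam_depth :: "real \<Rightarrow> real \<Rightarrow> real" where
  "lam_depth \<gamma> s = (- s + sqrt (s\<^sup>2 + 2 * \<gamma>)) / \<gamma>"

definition lam_R :: "real \<Rightarrow> real \<Rightarrow> real" where
  "lam_R \<gamma> s = s\<^sup>2 / 2 + \<gamma> + lam_depth \<gamma> s"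

definition s_crit :: "real \<Rightarrow> real" where
  "s_crit \<gamma> = (THE s. 0 < s \<and> (lam_R \<gamma> has_real_derivative 0) (at s))"

definition gamma_star :: real where
  "gamma_star = (THE \<gamma>. 0 < \<gamma> \<and> lam_R \<gamma> (s_crit \<gamma>) = \<gamma> / 2 + 2 / sqrt \<gamma>)"

definition crest_at :: "(real \<Rightarrow> real) \<Rightarrow> real \<Rightarrow> bool" where
  "crest_at \<eta> x \<longleftrightarrow> (\<forall>\<^sub>F y in nhds x. \<eta> y \<le> \<eta> x)"

definition trough_at :: "(real \<Rightarrow> real) \<Rightarrow> real \<Rightarrow> bool" where
  "trough_at \<eta> x \<longleftrightarrow> (\<forall>\<^sub>F y in nhds x. \<eta> x \<le> \<eta> y)"

definition x_period :: "(real \<Rightarrow> real) \<Rightarrow> (real \<times> real \<Rightarrow> real) \<Rightarrow> real \<Rightarrow> bool" where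
  "x_period \<eta> \<psi> L \<longleftrightarrow>
     0 < L \<and> (\<forall>x. \<eta> (x + L) = \<eta> x) \<and>
     (\<forall>(x, y)\<in>closed_fluid \<eta>. \<psi> (x + L, y) = \<psi> (x, y))"

definition stokes_wave ::
  "real \<Rightarrow> (real \<Rightarrow> real) \<Rightarrow> (real \<times> real \<Rightarrow> real) \<Rightarrow> real \<Rightarrow> bool" where
  "stokes_wave \<gamma> \<eta> \<psi> r \<longleftrightarrow>
     wave_solution \<gamma> \<eta> \<psi> r \<and>
     (\<exists>L. x_period \<eta> \<psi> L \<and> (\<forall>l. x_period \<eta> \<psi> l \<longrightarrow> L \<le> l) \<and>
          (\<exists>!x. x \<in> {0..<L} \<and> crest_at \<eta> x) \<and>
          (\<exists>!x. x \<in> {0..<L} \<and> trough_at \<eta> x))"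

text \<open>
  The background state has stream function \<open>\<gamma> * y\<^sup>2 / 2 + s * y\<close>, hence velocity
  \<open>(\<gamma> * y + s, 0)\<close>, and depth \<open>lam_depth \<gamma> s\<close>. Here \<open>s\<close> may be any real number; that the
  Bernoulli constants agree follows by passing to the limit.
\<close>

definition solitary_wave ::
  "real \<Rightarrow> (real \<Rightarrow> real) \<Rightarrow> (real \<times> real \<Rightarrow> real) \<Rightarrow> real \<Rightarrow> bool" where
  "solitary_wave \<gamma> \<eta> \<psi> r \<longleftrightarrow>
     wave_solution \<gamma> \<eta> \<psi> r \<and> \<not> laminar \<gamma> \<eta> \<psi> r \<and>
     (\<exists>s. (\<eta> \<longlongrightarrow> lam_depth \<gamma> s) at_infinity \<and>
          (\<forall>\<epsilon>>0. \<forall>\<^sub>F x in at_infinity. \<forall>y\<in>{0..\<eta> x}.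
             dist (velocity (closed_fluid \<eta>) \<psi> (x, y)) (\<gamma> * y + s, 0) < \<epsilon>))"

definition eta_hat :: "(real \<Rightarrow> real) \<Rightarrow> real" where
  "eta_hat \<eta> = (SUP x. \<eta> x)"

definition u_hat :: "(real \<Rightarrow> real) \<Rightarrow> (real \<times> real \<Rightarrow> real) \<Rightarrow> real" where
  "u_hat \<eta> \<psi> = fst (velocity (closed_fluid \<eta>) \<psi> (0, eta_hat \<eta>))"

text \<open>
  \<open>W\<close> is the type of wave, \<open>stokes_wave\<close> or \<open>solitary_wave\<close>. The condition
  \<open>\<forall>x. \<eta> t x \<le> \<eta> t 0\<close> is the normalisation that the wave is translated so that its (highest)
  crest is at \<open>x = 0\<close>; thus \<open>u_hat\<close> is evaluated at a point of the surface. Of the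
  continuity of the family in \<open>t\<close> only the continuity of three scalar quantities is demanded, so that
  the notion does not depend on a choice of topology on the space of waves.
\<close>

definition unidirectional_family ::
  "(real \<Rightarrow> (real \<Rightarrow> real) \<Rightarrow> (real \<times> real \<Rightarrow> real) \<Rightarrow> real \<Rightarrow> bool) \<Rightarrow> real \<Rightarrow> real \<Rightarrow>
   (real \<Rightarrow> real \<Rightarrow> real) \<Rightarrow> (real \<Rightarrow> real \<times> real \<Rightarrow> real) \<Rightarrow> (real \<Rightarrow> real) \<Rightarrow> bool" where
  "unidirectional_family W \<gamma> T \<eta> \<psi> r \<longleftrightarrow>
     0 < T \<and>
     laminar \<gamma> (\<eta> 0) (\<psi> 0) (r 0) \<and>
     (\<forall>t\<in>{0<..<T}. W \<gamma> (\<eta> t) (\<psi> t) (r t) \<and> (\<forall>x. \<eta> t x \<le> \<eta> t 0)) \<and>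
     (\<forall>t\<in>{0..<T}. unidirectional (\<eta> t) (\<psi> t)) \<and>
     continuous_on {0..<T} r \<and>
     continuous_on {0..<T} (\<lambda>t. eta_hat (\<eta> t)) \<and>
     continuous_on {0..<T} (\<lambda>t. u_hat (\<eta> t) (\<psi> t))"

text \<open>
  To speak about the formation of extreme and overhanging waves, the surface is allowed to be an
  arbitrary continuous injective curve \<open>c\<close>, possibly with corners, running from
  \<open>x = -\<infinity>\<close> to \<open>x = \<infinity>\<close>. The fluid domain \<open>D\<close> is the region between the bottom and \<open>c\<close>, and
  the stream function is only required to be continuously differentiable up to the boundary.
\<close>

definition general_wave ::
  "real \<Rightarrow> (real \<times> real) set \<Rightarrow> (real \<Rightarrow> real \<times> real) \<Rightarrow> (real \<times> real \<Rightarrow> real) \<Rightarrow> real \<Rightarrow> bool" where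
  "general_wave \<gamma> D c \<psi> r \<longleftrightarrow>
     continuous_on UNIV c \<and> inj c \<and> (\<forall>\<sigma>. 0 < snd (c \<sigma>)) \<and>
     filterlim (\<lambda>\<sigma>. fst (c \<sigma>)) at_top at_top \<and>
     filterlim (\<lambda>\<sigma>. fst (c \<sigma>)) at_bot at_bot \<and>
     open D \<and> connected D \<and> D \<noteq> {} \<and> D \<subseteq> {(x, y). 0 < y} \<and>
     frontier D = {(x, y). y = 0} \<union> range c \<and>
     smooth_on D \<psi> \<and>
     (\<forall>z\<in>closure D. \<psi> differentiable (at z within closure D)) \<and>
     continuous_on (closure D) (velocity (closure D) \<psi>) \<and>
     (\<forall>z\<in>D. laplacian D \<psi> z = \<gamma>) \<and>
     (\<forall>z\<in>range c. ((pdx (closure D) \<psi> z)\<^sup>2 + (pdy (closure D) \<psi> z)\<^sup>2) / 2 + snd z = r) \<and>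
     (\<forall>z\<in>range c. \<psi> z = 1) \<and>
     (\<forall>x. \<psi> (x, 0) = 0)"

definition extreme ::
  "(real \<times> real) set \<Rightarrow> (real \<Rightarrow> real \<times> real) \<Rightarrow> (real \<times> real \<Rightarrow> real) \<Rightarrow> bool" where
  "extreme D c \<psi> \<longleftrightarrow> (\<exists>z\<in>range c. velocity (closure D) \<psi> z = (0, 0))"

text \<open>
  Differentiability of \<open>h\<close> matters: a family passing from graphs to overhanging waves
  goes through a wave whose surface has a vertical tangent.
\<close>

definition differentiable_graph :: "(real \<Rightarrow> real \<times> real) \<Rightarrow> bool" where
  "differentiable_graph c \<longleftrightarrow>
     (\<exists>h :: real \<Rightarrow> real. (\<forall>x. h differentiable (at x)) \<and> range c = range (\<lambda>x. (x, h x)))"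

definition bottom_stagnation :: "(real \<times> real) set \<Rightarrow> (real \<times> real \<Rightarrow> real) \<Rightarrow> bool" where
  "bottom_stagnation D \<psi> \<longleftrightarrow> (\<exists>x. velocity (closure D) \<psi> (x, 0) = (0, 0))"

definition general_unidirectional :: "(real \<times> real) set \<Rightarrow> (real \<times> real \<Rightarrow> real) \<Rightarrow> bool" where
  "general_unidirectional D \<psi> \<longleftrightarrow> (\<forall>z\<in>closure D. 0 < fst (velocity (closure D) \<psi> z))"

text \<open>
  A general wave forms along a family if it is the limit of members of the family at
  some parameters \<open>\<tau> n\<close>, where \<open>\<xi> n\<close> reparametrises the graph of \<open>\<eta> (\<tau> n)\<close>. Only pointwise
  convergence of the surfaces, of the velocities on them, and of the velocities inside the fluid is
  asked for.
\<close>

definition forms_along ::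
  "real \<Rightarrow> (real \<Rightarrow> real \<Rightarrow> real) \<Rightarrow> (real \<Rightarrow> real \<times> real \<Rightarrow> real) \<Rightarrow>
   (real \<times> real) set \<Rightarrow> (real \<Rightarrow> real \<times> real) \<Rightarrow> (real \<times> real \<Rightarrow> real) \<Rightarrow> bool" where
  "forms_along T \<eta> \<psi> D c \<phi> \<longleftrightarrow>
     (\<exists>(\<tau> :: nat \<Rightarrow> real) (\<xi> :: nat \<Rightarrow> real \<Rightarrow> real).
        (\<forall>n. \<tau> n \<in> {0..<T}) \<and>
        (\<forall>n. continuous_on UNIV (\<xi> n) \<and> strict_mono (\<xi> n) \<and> surj (\<xi> n)) \<and>
        (\<forall>\<sigma>. (\<lambda>n. (\<xi> n \<sigma>, \<eta> (\<tau> n) (\<xi> n \<sigma>))) \<longlonglongrightarrow> c \<sigma>) \<and>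
        (\<forall>\<sigma>. (\<lambda>n. velocity (closed_fluid (\<eta> (\<tau> n))) (\<psi> (\<tau> n)) (\<xi> n \<sigma>, \<eta> (\<tau> n) (\<xi> n \<sigma>)))
               \<longlonglongrightarrow> velocity (closure D) \<phi> (c \<sigma>)) \<and>
        (\<forall>z\<in>D. (\<forall>\<^sub>F n in sequentially. z \<in> fluid (\<eta> (\<tau> n))) \<and>
               (\<lambda>n. velocity (closed_fluid (\<eta> (\<tau> n))) (\<psi> (\<tau> n)) z)
                 \<longlonglongrightarrow> velocity (closure D) \<phi> z))"

end

theory Submission
  imports Defs
begin

text \<open>
  Write \<open>u = \<psi>\<^sub>y\<close> and \<open>v = - \<psi>\<^sub>x\<close>. The proof combines three facts about a single unidirectional wave
  with a continuity argument along the family.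

  \<^item> The surplus \<open>u - \<gamma> \<eta> / 2\<close> of the surface velocity is least at the highest crest. The modified head
    \<open>h = (u\<^sup>2 + v\<^sup>2) / 2 + y - \<gamma> \<psi> / 2\<close> satisfies \<open>\<Delta>h = |D\<^sup>2\<psi>|\<^sup>2 - \<gamma>\<^sup>2 / 2 \<ge> 0\<close>, because
    \<open>\<gamma> = \<Delta>\<psi>\<close> and \<open>|D\<^sup>2\<psi>|\<^sup>2 \<ge> (\<Delta>\<psi>)\<^sup>2 / 2\<close>; it increases upwards at the bottom and is constant on the
    surface. By the maximum principle (\<open>fluid_max_principle\<close>) it is largest on the surface, so
    \<open>h\<^sub>y \<ge> 0\<close> there (\<open>head_dy_surface_nonneg\<close>). The derivative of the surplus along the surface is
    \<open>- \<eta>' h\<^sub>y / u\<close> (\<open>surplus_deriv\<close>): it does not grow as the surface rises, and it suffices to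
    look at points with \<open>\<eta>' = 0\<close>, where \<open>v = 0\<close> and Bernoulli's law makes it a decreasing function of the height.

  \<^item> The surplus at the crest is not zero when \<open>\<gamma>\<close> exceeds the threshold (\<open>surplus_crest_nonzero\<close>).
    If it were, the surplus would be nonnegative on the whole surface, hence \<open>u \<ge> \<gamma> y / 2\<close> in the
    fluid, as \<open>u - \<gamma> y / 2\<close> is harmonic and positive at the bottom. Integration over the depth gives
    \<open>\<gamma> \<eta>\<^sup>2 \<le> 4\<close>, and Bernoulli's law at the crest gives \<open>r = \<gamma>\<^sup>2 \<eta>\<^sup>2 / 8 + \<eta> \<le> \<gamma> / 2 + 2 / \<surd>\<gamma>\<close>.
    Above the threshold this is smaller than the critical value \<open>R(s\<^sub>c)\<close>.

  \<^item> Every wave has \<open>r \<ge> R(s\<^sub>c)\<close>. For a solitary wave \<open>r\<close> is the Bernoulli constant of the laminar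
    flow at infinity (\<open>solitary_limits\<close>). For a Stokes wave one compares with the laminar flow whose
    depth is that of the trough (\<open>bernoulli_constant_stokes\<close>).

  At the laminar end of the family the surplus is positive. It is continuous at the crest along the
  family and never vanishes there, so it stays positive, and with it the surplus on the whole surface.

  The second part follows by passing to limits. The inequality \<open>u \<ge> \<gamma> y / 2\<close> in the closed fluid survives
  and excludes surface stagnation, and stagnation inside. It also bounds the derivative of \<open>\<eta>\<^sup>2\<close>
  uniformly (\<open>eta_square_lipschitz\<close>), so that the limiting surface is a graph; being a level curve of a
  function with positive vertical derivative, this graph is differentiable.
\<close>

section \<open>The critical laminar flow\<close>

lemma lam_depth_alt:
  assumes "0 < \<gamma>"
  shows "lam_depth \<gamma> s = 2 / (s + sqrt (s\<^sup>2 + 2 * \<gamma>))"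
proof -
  have "\<bar>s\<bar> < sqrt (s\<^sup>2 + 2 * \<gamma>)"
    using assms by (intro real_less_rsqrt) simp
  hence p: "0 < s + sqrt (s\<^sup>2 + 2 * \<gamma>)" by linarith
  have "(- s + sqrt (s\<^sup>2 + 2 * \<gamma>)) * (s + sqrt (s\<^sup>2 + 2 * \<gamma>)) = 2 * \<gamma>"
    using assms real_sqrt_pow2[of "s\<^sup>2 + 2 * \<gamma>"]
    by (simp add: algebra_simps power2_eq_square)
  thus ?thesis
    using p assms by (simp add: lam_depth_def field_simps)
qed

lemma lam_depth_pos: "0 < \<gamma> \<Longrightarrow> 0 < lam_depth \<gamma> s"
proof -
  assume "0 < \<gamma>"
  hence "\<bar>s\<bar> < sqrt (s\<^sup>2 + 2 * \<gamma>)" by (intro real_less_rsqrt) simp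
  thus ?thesis using \<open>0 < \<gamma>\<close> by (simp add: lam_depth_def)
qed

definition lam_R_deriv :: "real \<Rightarrow> real \<Rightarrow> real" where
  "lam_R_deriv \<gamma> s = s - 1 / \<gamma> + s / sqrt (s\<^sup>2 + 2 * \<gamma>) / \<gamma>"

lemma has_derivative_lam_R:
  assumes "0 < \<gamma>"
  shows "(lam_R \<gamma> has_real_derivative lam_R_deriv \<gamma> s) (at s)"
proof -
  have "0 < s\<^sup>2 + 2 * \<gamma>" using assms by (intro add_nonneg_pos) auto
  thus ?thesis
    unfolding lam_R_def[abs_def] lam_R_deriv_def lam_depth_def
    using assms by (auto intro!: derivative_eq_intros simp: field_simps)
qed

lemma lam_R_deriv_strict_mono:
  assumes "0 < \<gamma>" "a < b"
  shows "lam_R_deriv \<gamma> a < lam_R_deriv \<gamma> b"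
proof -
  have "\<exists>z. ((\<lambda>s. s / sqrt (s\<^sup>2 + 2 * \<gamma>)) has_real_derivative z) (at s) \<and> 0 \<le> z" for s
  proof -
    have p: "0 < s\<^sup>2 + 2 * \<gamma>" using assms by (intro add_nonneg_pos) auto
    let ?q = "sqrt (s\<^sup>2 + 2 * \<gamma>)"
    have "((\<lambda>s. s / sqrt (s\<^sup>2 + 2 * \<gamma>)) has_real_derivative (1 * ?q - s * (s / ?q)) / (?q * ?q)) (at s)"
      using p by (auto intro!: derivative_eq_intros simp: field_simps)
    moreover have "s * (s / ?q) \<le> ?q"
      using p assms by (simp add: field_simps power2_eq_square)
    ultimately show ?thesis using p by (intro exI conjI) auto
  qed
  hence "a / sqrt (a\<^sup>2 + 2 * \<gamma>) \<le> b / sqrt (b\<^sup>2 + 2 * \<gamma>)"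
    using assms by (intro DERIV_nonneg_imp_nondecreasing[of a b "\<lambda>s. s / sqrt (s\<^sup>2 + 2 * \<gamma>)"]) auto
  hence "a / sqrt (a\<^sup>2 + 2 * \<gamma>) / \<gamma> \<le> b / sqrt (b\<^sup>2 + 2 * \<gamma>) / \<gamma>"
    using assms by (intro divide_right_mono) auto
  thus ?thesis using assms by (simp add: lam_R_deriv_def)
qed

lemma s_crit:
  assumes "0 < \<gamma>"
  shows "0 < s_crit \<gamma>" and "lam_R_deriv \<gamma> (s_crit \<gamma>) = 0"
proof -
  have "continuous_on {0..1 / \<gamma>} (lam_R_deriv \<gamma>)"
    unfolding lam_R_deriv_def[abs_def] using assms
    by (intro continuous_intros) (auto simp: add_nonneg_eq_0_iff)
  moreover have "lam_R_deriv \<gamma> 0 < 0" and "0 \<le> lam_R_deriv \<gamma> (1 / \<gamma>)"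
    using assms by (auto simp: lam_R_deriv_def)
  ultimately obtain s where s: "0 \<le> s" "lam_R_deriv \<gamma> s = 0"
    using IVT'[of "lam_R_deriv \<gamma>" 0 0 "1 / \<gamma>"] assms by auto
  have "s \<noteq> 0" using s \<open>lam_R_deriv \<gamma> 0 < 0\<close> by auto
  have "s_crit \<gamma> = s" unfolding s_crit_def
  proof (rule the_equality)
    show "0 < s \<and> (lam_R \<gamma> has_real_derivative 0) (at s)"
      using s \<open>s \<noteq> 0\<close> has_derivative_lam_R[OF assms, of s] by auto
    fix s' assume "0 < s' \<and> (lam_R \<gamma> has_real_derivative 0) (at s')"
    hence "lam_R_deriv \<gamma> s' = 0"
      using has_derivative_lam_R[OF assms, of s'] DERIV_unique by blast
    thus "s' = s" using s lam_R_deriv_strict_mono[OF assms] by (metis linorder_less_linear order_less_irrefl)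
  qed
  thus "0 < s_crit \<gamma>" and "lam_R_deriv \<gamma> (s_crit \<gamma>) = 0" using s \<open>s \<noteq> 0\<close> by auto
qed

lemma lam_R_min:
  assumes "0 < \<gamma>"
  shows "lam_R \<gamma> (s_crit \<gamma>) \<le> lam_R \<gamma> s"
proof (cases "s_crit \<gamma> \<le> s")
  case True
  show ?thesis
  proof (rule DERIV_nonneg_imp_nondecreasing[OF True])
    fix x assume "s_crit \<gamma> \<le> x"
    hence "0 \<le> lam_R_deriv \<gamma> x"
      using lam_R_deriv_strict_mono[OF assms] s_crit(2)[OF assms] by (metis order_le_less)
    thus "\<exists>y. (lam_R \<gamma> has_real_derivative y) (at x) \<and> 0 \<le> y"
      using has_derivative_lam_R[OF assms] by blast
  qed
next
  case False
  show ?thesis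
  proof (rule DERIV_nonpos_imp_nonincreasing[of s "s_crit \<gamma>"])
    show "s \<le> s_crit \<gamma>" using False by simp
  next
    fix x assume "x \<le> s_crit \<gamma>"
    hence "lam_R_deriv \<gamma> x \<le> 0"
      using lam_R_deriv_strict_mono[OF assms] s_crit(2)[OF assms] by (metis order_le_less)
    thus "\<exists>y. (lam_R \<gamma> has_real_derivative y) (at x) \<and> y \<le> 0"
      using has_derivative_lam_R[OF assms] by blast
  qed
qed

text \<open>
  The number \<open>gamma_star\<close> is the zero of this function; the subtracted term is an upper bound for
  the Bernoulli constants of waves on which \<open>u - \<gamma> \<eta> / 2\<close> has minimum zero, attained at the crest.
\<close>

definition crit_gap :: "real \<Rightarrow> real" where
  "crit_gap \<gamma> = lam_R \<gamma> (s_crit \<gamma>) - (\<gamma> / 2 + 2 / sqrt \<gamma>)"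

text \<open>
  The second bound is where the threshold gets its uniqueness: as \<open>\<gamma>\<close> grows, the depth falls by no more than
  \<open>2 / \<surd>\<gamma>\<close> does, because \<open>s + \<surd>(s\<^sup>2 + 2\<gamma>) \<ge> \<surd>(2\<gamma>)\<close> for \<open>s \<ge> 0\<close>.
\<close>

lemma lam_depth_decreasing:
  assumes "0 < a" "a \<le> b" "0 \<le> s"
  shows "lam_depth b s \<le> lam_depth a s"
    and "lam_depth a s - lam_depth b s \<le> 2 / sqrt a - 2 / sqrt b"
proof -
  define p q where "p = sqrt a" and "q = sqrt b"
  define p' q' where "p' = sqrt (s\<^sup>2 + 2 * a)" and "q' = sqrt (s\<^sup>2 + 2 * b)"
  have pq: "0 < p" "p \<le> q" "p\<^sup>2 = a" "q\<^sup>2 = b"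
    using assms by (auto simp: p_def q_def)
  have sq: "p'\<^sup>2 = s\<^sup>2 + 2 * p\<^sup>2" "q'\<^sup>2 = s\<^sup>2 + 2 * q\<^sup>2"
    using assms pq by (auto simp: p'_def q'_def add_nonneg_nonneg)
  have pp: "p \<le> p'" "q \<le> q'"
    using assms by (auto simp: p_def q_def p'_def q'_def intro!: real_sqrt_le_mono)
  have "p' \<le> q'" using assms by (auto simp: p'_def q'_def)
  have d: "lam_depth a s = 2 / (s + p')" "lam_depth b s = 2 / (s + q')"
    using assms by (auto simp: lam_depth_alt p'_def q'_def)
  show "lam_depth b s \<le> lam_depth a s"
    unfolding d using \<open>p' \<le> q'\<close> pp pq assms by (intro divide_left_mono) auto
  have frac: "x / B \<le> y / A" if "x * A \<le> y * B" "0 < A" "0 < B" for x y A B :: real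
    using that by (simp add: field_simps)
  have "(q' - p') * (p' + q') = 2 * ((q - p) * (p + q))"
    using sq by (simp add: algebra_simps power2_eq_square)
  moreover have "2 * ((q - p) * (p + q)) * (p * q) \<le> (q - p) * ((s + p') * (s + q') * (p' + q'))"
  proof -
    have pp2: "p\<^sup>2 * 2 \<le> p'\<^sup>2" "q\<^sup>2 * 2 \<le> q'\<^sup>2" using sq by auto
    have a: "(2 * (p * q))\<^sup>2 \<le> (p' * q')\<^sup>2"
      using mult_mono[OF pp2] by (simp add: power_mult_distrib algebra_simps)
    have "2 * (p * q) \<le> p' * q'"
      using power2_le_imp_le[OF a] pp pq by auto
    also have "\<dots> \<le> (s + p') * (s + q')" using pp pq assms by (intro mult_mono) auto
    finally have "(2 * (p * q)) * (p + q) \<le> ((s + p') * (s + q')) * (p' + q')"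
      by (rule mult_mono) (use pp pq assms in auto)
    from mult_left_mono[OF this, of "q - p"] pq show ?thesis by (simp add: algebra_simps)
  qed
  ultimately have "(q' - p') * (p * q) * (p' + q') \<le> (q - p) * ((s + p') * (s + q')) * (p' + q')"
    by (smt (verit) mult.commute mult.left_commute)
  hence "(q' - p') * (p * q) \<le> (q - p) * ((s + p') * (s + q'))"
    using pp pq by (simp add: mult_le_cancel_right)
  moreover have "0 < p * q" "0 < (s + p') * (s + q')"
    using pp pq assms by (auto intro!: mult_pos_pos)
  ultimately have "2 * ((q' - p') / ((s + p') * (s + q'))) \<le> 2 * ((q - p) / (p * q))"
    by (intro mult_left_mono frac) auto
  moreover have "2 / (s + p') - 2 / (s + q') = 2 * ((q' - p') / ((s + p') * (s + q')))"
    using pp pq assms by (simp add: field_simps add_nonneg_eq_0_iff)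
  moreover have "2 / p - 2 / q = 2 * ((q - p) / (p * q))"
    using pp pq assms by (simp add: field_simps)
  ultimately show "lam_depth a s - lam_depth b s \<le> 2 / sqrt a - 2 / sqrt b"
    unfolding d p_def[symmetric] q_def[symmetric] by linarith
qed

text \<open>
  Both bounds use that \<open>lam_R \<gamma>\<close> is least at \<open>s_crit \<gamma>\<close>: a minimum over \<open>s\<close> is estimated from above
  by the value at the minimiser belonging to the other parameter. The first bound gives strict
  monotonicity, and both together give continuity.
\<close>

lemma crit_gap_bounds:
  assumes "0 < a" "a \<le> b"
  shows "crit_gap a + (b - a) / 2 \<le> crit_gap b"
    and "crit_gap b \<le> crit_gap a + ((b / 2 - 2 / sqrt b) - (a / 2 - 2 / sqrt a))"
proof -
  have b: "0 < b" using assms by simp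
  have "lam_R a (s_crit a) \<le> lam_R a (s_crit b)" by (rule lam_R_min) fact
  moreover have "lam_depth a (s_crit b) - lam_depth b (s_crit b) \<le> 2 / sqrt a - 2 / sqrt b"
    using assms s_crit(1)[OF b] by (intro lam_depth_decreasing) auto
  ultimately show "crit_gap a + (b - a) / 2 \<le> crit_gap b"
    by (auto simp: crit_gap_def lam_R_def field_simps)
  have "lam_R b (s_crit b) \<le> lam_R b (s_crit a)" by (rule lam_R_min) fact
  moreover have "lam_depth b (s_crit a) \<le> lam_depth a (s_crit a)"
    using assms s_crit(1)[of a] by (intro lam_depth_decreasing) auto
  ultimately show "crit_gap b \<le> crit_gap a + ((b / 2 - 2 / sqrt b) - (a / 2 - 2 / sqrt a))"
    by (auto simp: crit_gap_def lam_R_def field_simps)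
qed

lemma continuous_on_crit_gap: "continuous_on {0<..} crit_gap"
  unfolding continuous_on
proof
  fix a :: real assume a: "a \<in> {0<..}"
  let ?c = "\<lambda>x. x / 2 - 2 / sqrt x"
  have c: "(?c \<longlongrightarrow> ?c a) (at a within {0<..})"
    using a by (intro tendsto_intros) auto
  have "((\<lambda>x. crit_gap x - crit_gap a) \<longlongrightarrow> 0) (at a within {0<..})"
  proof (rule Lim_null_comparison)
    show "((\<lambda>x. \<bar>?c x - ?c a\<bar>) \<longlongrightarrow> 0) (at a within {0<..})"
      using tendsto_rabs[OF tendsto_diff[OF c tendsto_const[of "?c a"]]] by simp
    show "\<forall>\<^sub>F x in at a within {0<..}. norm (crit_gap x - crit_gap a) \<le> \<bar>?c x - ?c a\<bar>"
      unfolding eventually_at_filter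
    proof (intro always_eventually allI impI)
      fix x :: real assume x: "x \<in> {0<..}"
      have "0 < a" "0 < x" using a x by auto
      show "norm (crit_gap x - crit_gap a) \<le> \<bar>?c x - ?c a\<bar>"
      proof (cases "a \<le> x")
        case True
        hence "0 \<le> (x - a) / 2" by simp
        hence "0 \<le> crit_gap x - crit_gap a" "crit_gap x - crit_gap a \<le> ?c x - ?c a"
          using crit_gap_bounds[OF \<open>0 < a\<close> True] by linarith+
        thus ?thesis by (simp only: real_norm_def abs_of_nonneg abs_ge_self order_trans)
      next
        case False
        hence "x \<le> a" by simp
        hence "0 \<le> (a - x) / 2" by simp
        hence "0 \<le> crit_gap a - crit_gap x" "crit_gap a - crit_gap x \<le> ?c a - ?c x"
          using crit_gap_bounds[OF \<open>0 < x\<close> \<open>x \<le> a\<close>] by linarith+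
        thus ?thesis
          by (simp only: real_norm_def abs_minus_commute[of _ "crit_gap a"]
              abs_minus_commute[of _ "?c a"] abs_of_nonneg abs_ge_self order_trans)
      qed
    qed
  qed
  thus "(crit_gap \<longlongrightarrow> crit_gap a) (at a within {0<..})"
    using LIM_zero_cancel by blast
qed

lemma gamma_star:
  shows "0 < gamma_star" and "crit_gap gamma_star = 0"
proof -
  have "crit_gap 1 \<le> 0"
  proof -
    have "lam_R 1 (s_crit 1) \<le> lam_R 1 0" by (rule lam_R_min) simp
    also have "lam_R 1 0 = 1 + sqrt 2" by (simp add: lam_R_def lam_depth_def)
    also have "sqrt 2 \<le> (3 / 2 :: real)" by (rule real_le_lsqrt) (auto simp: power2_eq_square)
    finally show ?thesis by (simp add: crit_gap_def)
  qed
  moreover have "0 \<le> crit_gap 4"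
    using lam_depth_pos[of 4 "s_crit 4"] by (auto simp: crit_gap_def lam_R_def)
  moreover have "continuous_on {1..4} crit_gap"
    by (rule continuous_on_subset[OF continuous_on_crit_gap]) auto
  ultimately obtain g where g: "1 \<le> g" "crit_gap g = 0"
    using IVT'[of crit_gap 1 0 4] by auto
  have "gamma_star = g" unfolding gamma_star_def
  proof (rule the_equality)
    show "0 < g \<and> lam_R g (s_crit g) = g / 2 + 2 / sqrt g"
      using g by (auto simp: crit_gap_def)
    fix g' assume "0 < g' \<and> lam_R g' (s_crit g') = g' / 2 + 2 / sqrt g'"
    hence "0 < g'" "crit_gap g' = 0" by (auto simp: crit_gap_def)
    thus "g' = g"
      using crit_gap_bounds(1)[of g g'] crit_gap_bounds(1)[of g' g] g
      by (cases "g \<le> g'") auto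
  qed
  thus "0 < gamma_star" and "crit_gap gamma_star = 0" using g by auto
qed

lemma above_gamma_star:
  assumes "gamma_star < \<gamma>"
  shows "0 < \<gamma>" and "\<gamma> / 2 + 2 / sqrt \<gamma> < lam_R \<gamma> (s_crit \<gamma>)"
  using assms gamma_star crit_gap_bounds(1)[of gamma_star \<gamma>] by (auto simp: crit_gap_def)

section \<open>A maximum principle in the fluid domain\<close>

lemma local_max_second_derivative:
  fixes f :: "real \<Rightarrow> real"
  assumes "0 < d"
    and f: "\<And>y. \<bar>y - x\<bar> < d \<Longrightarrow> (f has_real_derivative f' y) (at y)"
    and f': "(f' has_real_derivative l) (at x)"
    and max: "\<And>y. \<bar>y - x\<bar> < d \<Longrightarrow> f y \<le> f x"
  shows "l \<le> 0"
proof (rule ccontr)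
  assume "\<not> l \<le> 0"
  have "f' x = 0"
    using DERIV_local_max[of f "f' x" x d] f[of x] max \<open>0 < d\<close> by (auto simp: abs_minus_commute)
  with \<open>\<not> l \<le> 0\<close> obtain e where "0 < e" and e: "\<And>h. 0 < h \<Longrightarrow> h < e \<Longrightarrow> 0 < f' (x + h)"
    using DERIV_pos_inc_right[OF f'] by auto
  define h where "h = min d e / 2"
  have h: "0 < h" "h < d" "h < e" using \<open>0 < d\<close> \<open>0 < e\<close> by (auto simp: h_def)
  have "\<exists>z. x < z \<and> z < x + h \<and> f (x + h) - f x = (x + h - x) * f' z"
    using h by (intro MVT2 f) auto
  then obtain z where z: "x < z" "z < x + h" "f (x + h) - f x = h * f' z" by auto
  hence "0 < f' z" using e[of "z - x"] h by auto
  hence "f x < f (x + h)" using z h by (metis diff_gt_0_iff_gt mult_pos_pos)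
  thus False using max[of "x + h"] h by auto
qed

lemma open_fluid: "continuous_on UNIV \<eta> \<Longrightarrow> open (fluid \<eta>)"
proof -
  assume c: "continuous_on UNIV \<eta>"
  have "fluid \<eta> = {z. 0 < snd z} \<inter> {z. snd z < \<eta> (fst z)}"
    by (auto simp: fluid_def)
  moreover have "open {z :: real \<times> real. 0 < snd z}" "open {z. snd z < \<eta> (fst z)}"
    by (auto intro!: open_Collect_less continuous_intros continuous_on_compose2[OF c])
  ultimately show ?thesis by auto
qed

lemma closed_closed_fluid: "continuous_on UNIV \<eta> \<Longrightarrow> closed (closed_fluid \<eta>)"
proof -
  assume c: "continuous_on UNIV \<eta>"
  have "closed_fluid \<eta> = {z. 0 \<le> snd z} \<inter> {z. snd z \<le> \<eta> (fst z)}"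
    by (auto simp: closed_fluid_def)
  moreover have "closed {z :: real \<times> real. 0 \<le> snd z}" "closed {z. snd z \<le> \<eta> (fst z)}"
    by (auto intro!: closed_Collect_le continuous_intros continuous_on_compose2[OF c])
  ultimately show ?thesis by auto
qed

lemma compact_fluid_box:
  assumes "continuous_on UNIV \<eta>"
  shows "compact (closed_fluid \<eta> \<inter> {z. \<bar>fst z\<bar> \<le> X})"
proof -
  have "compact (\<eta> ` {-X..X})"
    by (intro compact_continuous_image continuous_on_subset[OF assms]) auto
  then obtain H where H: "\<And>x. \<bar>x\<bar> \<le> X \<Longrightarrow> \<eta> x \<le> H"
    using compact_imp_bounded[THEN bounded_imp_bdd_above] by (fastforce simp: bdd_above_def abs_le_iff)
  have "closed_fluid \<eta> \<inter> {z. \<bar>fst z\<bar> \<le> X}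
      = closed_fluid \<eta> \<inter> ({-X..X} \<times> {0..H})"
    using H by (fastforce simp: closed_fluid_def)
  thus ?thesis
    using closed_Int_compact[OF closed_closed_fluid[OF assms] compact_Times[OF compact_Icc compact_Icc]]
    by metis
qed

text \<open>
  Periodic and solitary waves are treated alike in the unbounded domain: the perturbation
  \<open>\<epsilon> y\<^sup>2 - \<epsilon> x\<^sup>2 / 2\<close> has the positive Laplacian \<open>\<epsilon>\<close> and, since \<open>g\<close> is bounded above, forces the maximum
  to be attained. Its vertical derivative vanishes at the bottom, so that at bottom points, instead of a
  bound on \<open>g\<close>, a positive vertical derivative is enough.
\<close>

lemma fluid_max_principle:
  fixes g :: "real \<times> real \<Rightarrow> real"
  assumes \<eta>: "continuous_on UNIV \<eta>" "\<And>x. 0 < \<eta> x" "\<And>x. \<eta> x \<le> H"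
    and cont: "continuous_on (closed_fluid \<eta>) g"
    and bdd: "\<And>z. z \<in> closed_fluid \<eta> \<Longrightarrow> g z \<le> B"
    and gx: "\<And>x y. (x, y) \<in> fluid \<eta> \<Longrightarrow> ((\<lambda>t. g (t, y)) has_real_derivative gx (x, y)) (at x)"
    and gxx: "\<And>x y. (x, y) \<in> fluid \<eta> \<Longrightarrow> ((\<lambda>t. gx (t, y)) has_real_derivative gxx (x, y)) (at x)"
    and gy: "\<And>x y. (x, y) \<in> fluid \<eta> \<Longrightarrow> ((\<lambda>t. g (x, t)) has_real_derivative gy (x, y)) (at y)"
    and gyy: "\<And>x y. (x, y) \<in> fluid \<eta> \<Longrightarrow> ((\<lambda>t. gy (x, t)) has_real_derivative gyy (x, y)) (at y)"
    and subharmonic: "\<And>z. z \<in> fluid \<eta> \<Longrightarrow> 0 \<le> gxx z + gyy z"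
    and surface: "\<And>x. g (x, \<eta> x) \<le> M"
    and bottom: "\<And>x. g (x, 0) \<le> M \<or>
       (\<exists>b>0. ((\<lambda>t. g (x, t)) has_real_derivative b) (at 0 within {0..\<eta> x}))"
    and z: "z \<in> closed_fluid \<eta>"
  shows "g z \<le> M"
proof -
  have main: "g (x0, y0) + \<epsilon> * y0\<^sup>2 - \<epsilon> / 2 * x0\<^sup>2 \<le> M + \<epsilon> * H\<^sup>2"
    if "0 < \<epsilon>" and z0: "(x0, y0) \<in> closed_fluid \<eta>" for \<epsilon> x0 y0
  proof (rule ccontr)
    define k where "k = (\<lambda>z. g z + \<epsilon> * (snd z)\<^sup>2 - \<epsilon> / 2 * (fst z)\<^sup>2)"
    assume "\<not> ?thesis"
    hence big: "M + \<epsilon> * H\<^sup>2 < k (x0, y0)" by (simp add: k_def)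
    have y2: "y\<^sup>2 \<le> H\<^sup>2" if "(x, y) \<in> closed_fluid \<eta>" for x y
      using that \<eta>(3)[of x] by (intro power_mono) (auto simp: closed_fluid_def)
    (* beyond X the term - \<epsilon> x^2 / 2 makes k smaller than at the given point *)
    define X where "X = 1 + \<bar>(B + \<epsilon> * H\<^sup>2 - k (x0, y0)) * 2 / \<epsilon>\<bar>"
    have far: "k z < k (x0, y0)" if "z \<in> closed_fluid \<eta>" "X < \<bar>fst z\<bar>" for z
    proof -
      obtain x y where xy: "z = (x, y)" by (cases z)
      have "1 \<le> X" by (simp add: X_def)
      hence "X * 1 \<le> \<bar>x\<bar> * \<bar>x\<bar>" using that xy by (intro mult_mono) auto
      hence "(B + \<epsilon> * H\<^sup>2 - k (x0, y0)) * 2 / \<epsilon> < x\<^sup>2"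
        using abs_ge_self[of "(B + \<epsilon> * H\<^sup>2 - k (x0, y0)) * 2 / \<epsilon>"]
        unfolding X_def power2_eq_square abs_mult_self_eq by argo
      hence "B + \<epsilon> * H\<^sup>2 - k (x0, y0) < \<epsilon> / 2 * x\<^sup>2"
        using \<open>0 < \<epsilon>\<close> by (simp add: field_simps)
      moreover have "g z + \<epsilon> * y\<^sup>2 \<le> B + \<epsilon> * H\<^sup>2"
        using bdd[OF that(1)] y2 that xy \<open>0 < \<epsilon>\<close> by (intro add_mono mult_left_mono) auto
      ultimately show ?thesis by (simp add: k_def xy)
    qed
    let ?K = "closed_fluid \<eta> \<inter> {z. \<bar>fst z\<bar> \<le> X}"
    have "(x0, y0) \<in> ?K" using far z0 by force
    moreover have "continuous_on ?K k"
      unfolding k_def by (intro continuous_intros continuous_on_subset[OF cont]) auto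
    ultimately obtain zm where zm: "zm \<in> ?K" "\<And>z. z \<in> ?K \<Longrightarrow> k z \<le> k zm"
      using continuous_attains_sup[OF compact_fluid_box[OF \<eta>(1), of X], of k] by blast
    have max: "k z \<le> k zm" if "z \<in> closed_fluid \<eta>" for z
      using that far[of z] zm(2)[of z] zm(2)[OF \<open>(x0, y0) \<in> ?K\<close>] by (cases "X < \<bar>fst z\<bar>") auto
    have kzm: "M + \<epsilon> * H\<^sup>2 < k zm" using big max[OF z0] by simp
    obtain x y where xy: "zm = (x, y)" by (cases zm)
    have S: "(x, y) \<in> closed_fluid \<eta>" using zm xy by auto
    have gbig: "M < g (x, y)"
    proof -
      have "\<epsilon> * y\<^sup>2 \<le> \<epsilon> * H\<^sup>2" "0 \<le> \<epsilon> / 2 * x\<^sup>2"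
        using \<open>0 < \<epsilon>\<close> by (auto intro!: mult_left_mono y2[OF S])
      thus ?thesis using kzm unfolding k_def xy fst_conv snd_conv by linarith
    qed
    consider "y = \<eta> x" | "y = 0" | "(x, y) \<in> fluid \<eta>"
      using S by (force simp: closed_fluid_def fluid_def)
    thus False
    proof cases
      case 1 thus False using gbig surface[of x] by simp
    next
      case 2
      then obtain b where "0 < b"
        and b: "((\<lambda>t. g (x, t)) has_real_derivative b) (at 0 within {0..\<eta> x})"
        using bottom[of x] gbig by auto
      have "((\<lambda>t. k (x, t)) has_real_derivative b) (at 0 within {0..\<eta> x})"
        unfolding k_def by (auto intro!: derivative_eq_intros b)
      from has_real_derivative_pos_inc_right[OF this \<open>0 < b\<close>] obtain d where "0 < d"
        and d: "\<And>h. 0 < h \<Longrightarrow> h \<in> {0..\<eta> x} \<Longrightarrow> h < d \<Longrightarrow> k (x, 0) < k (x, h)" by auto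
      define h where "h = min (d / 2) (\<eta> x)"
      have h: "0 < h" "h < d" "h \<le> \<eta> x" using \<open>0 < d\<close> \<eta>(2)[of x] by (auto simp: h_def)
      hence "k (x, 0) < k (x, h)" using d by auto
      moreover have "(x, h) \<in> closed_fluid \<eta>" using h by (auto simp: closed_fluid_def)
      ultimately show False using max[of "(x, h)"] 2 xy by auto
    next
      case 3
      obtain d where "0 < d" and d: "ball (x, y) d \<subseteq> fluid \<eta>"
        using open_fluid[OF \<eta>(1)] 3 openE by blast
      have near: "(x', y') \<in> fluid \<eta>" if "\<bar>x' - x\<bar> + \<bar>y' - y\<bar> < d" for x' y'
      proof -
        have "dist (x, y) (x', y') \<le> dist x x' + dist y y'"
          using norm_Pair_le[of "x - x'" "y - y'"] by (simp add: dist_norm)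
        thus ?thesis using that d by (auto simp: dist_real_def abs_minus_commute)
      qed
      have F: "fluid \<eta> \<subseteq> closed_fluid \<eta>" by (auto simp: fluid_def closed_fluid_def)
      have "gxx (x, y) - \<epsilon> \<le> 0"
      proof (rule local_max_second_derivative[OF \<open>0 < d\<close>])
        show "((\<lambda>t. k (t, y)) has_real_derivative gx (x', y) - \<epsilon> * x') (at x')" if "\<bar>x' - x\<bar> < d" for x'
          unfolding k_def using near[of x' y] that
          by (auto intro!: derivative_eq_intros gx)
        show "((\<lambda>x'. gx (x', y) - \<epsilon> * x') has_real_derivative gxx (x, y) - \<epsilon>) (at x)"
          using 3 by (auto intro!: derivative_eq_intros gxx)
        show "k (x', y) \<le> k (x, y)" if "\<bar>x' - x\<bar> < d" for x'
          using max[of "(x', y)"] near[of x' y] that F xy by auto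
      qed
      moreover have "gyy (x, y) + 2 * \<epsilon> \<le> 0"
      proof (rule local_max_second_derivative[OF \<open>0 < d\<close>])
        show "((\<lambda>t. k (x, t)) has_real_derivative gy (x, y') + 2 * \<epsilon> * y') (at y')" if "\<bar>y' - y\<bar> < d" for y'
          unfolding k_def using near[of x y'] that
          by (auto intro!: derivative_eq_intros gy)
        show "((\<lambda>y'. gy (x, y') + 2 * \<epsilon> * y') has_real_derivative gyy (x, y) + 2 * \<epsilon>) (at y)"
          using 3 by (auto intro!: derivative_eq_intros gyy)
        show "k (x, y') \<le> k (x, y)" if "\<bar>y' - y\<bar> < d" for y'
          using max[of "(x, y')"] near[of x y'] that F xy by auto
      qed
      ultimately show False using subharmonic[OF 3] \<open>0 < \<epsilon>\<close> by simp
    qed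
  qed
  obtain x y where xy: "z = (x, y)" by (cases z)
  show ?thesis
  proof (rule field_le_epsilon)
    fix e :: real assume "0 < e"
    define \<epsilon> where "\<epsilon> = e / (H\<^sup>2 + x\<^sup>2 / 2 + 1)"
    have p: "0 < H\<^sup>2 + x\<^sup>2 / 2 + 1" by (intro add_nonneg_pos) auto
    have "0 < \<epsilon>" using \<open>0 < e\<close> p by (simp add: \<epsilon>_def)
    have "g (x, y) \<le> M + \<epsilon> * H\<^sup>2 + \<epsilon> / 2 * x\<^sup>2 - \<epsilon> * y\<^sup>2"
      using main[OF \<open>0 < \<epsilon>\<close>] z xy by force
    also have "\<dots> \<le> M + \<epsilon> * (H\<^sup>2 + x\<^sup>2 / 2 + 1)"
      using mult_nonneg_nonneg[of \<epsilon> "y\<^sup>2"] \<open>0 < \<epsilon>\<close> by (simp add: algebra_simps)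
    also have "\<dots> = M + e" using p by (simp add: \<epsilon>_def)
    finally show "g z \<le> M + e" using xy by simp
  qed
qed

section \<open>Derivatives within the closed fluid domain\<close>

lemma has_real_derivative_along:
  fixes f :: "real \<times> real \<Rightarrow> real"
  assumes f: "(f has_derivative (\<lambda>(h, k). a * h + b * k)) (at (p t, q t) within S)"
    and p: "(p has_real_derivative p') (at t within T)"
    and q: "(q has_real_derivative q') (at t within T)"
    and S: "\<And>s. s \<in> T \<Longrightarrow> (p s, q s) \<in> S"
  shows "((\<lambda>s. f (p s, q s)) has_real_derivative a * p' + b * q') (at t within T)"
proof -
  have "((\<lambda>s. (p s, q s)) has_derivative (\<lambda>h. (p' * h, q' * h))) (at t within T)"
    using p q unfolding has_field_derivative_def by (intro has_derivative_Pair)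
  moreover have "(f has_derivative (\<lambda>(h, k). a * h + b * k)) (at (p t, q t) within (\<lambda>s. (p s, q s)) ` T)"
    by (rule has_derivative_subset[OF f]) (use S in auto)
  ultimately have "((\<lambda>s. f (p s, q s)) has_derivative
      (\<lambda>h. (\<lambda>(h, k). a * h + b * k) (p' * h, q' * h))) (at t within T)"
    by (rule has_derivative_in_compose)
  thus ?thesis unfolding has_field_derivative_def
    by (rule has_derivative_eq_rhs) (simp add: fun_eq_iff algebra_simps)
qed

lemma has_derivative_pair_coefficients:
  fixes f :: "real \<times> real \<Rightarrow> real"
  assumes "(f has_derivative D) F"
  shows "(f has_derivative (\<lambda>(h, k). D (1, 0) * h + D (0, 1) * k)) F"
proof -
  interpret D: bounded_linear D using assms by (rule has_derivative_bounded_linear)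
  have D: "D (h, k) = D (1, 0) * h + D (0, 1) * k" for h k
  proof -
    have "(h, k) = h *\<^sub>R (1, 0) + k *\<^sub>R (0, 1)" by simp
    hence "D (h, k) = D (h *\<^sub>R (1, 0) + k *\<^sub>R (0, 1))" by (rule arg_cong)
    also have "\<dots> = h *\<^sub>R D (1, 0) + k *\<^sub>R D (0, 1)" by (simp only: D.add D.scaleR)
    finally show ?thesis by (simp only: real_scaleR_def mult.commute)
  qed
  have "D = (\<lambda>(h, k). D (1, 0) * h + D (0, 1) * k)"
    by (rule ext, clarify, rule D)
  with assms show ?thesis by (rule has_derivative_eq_rhs)
qed

lemma has_real_derivative_unique_Icc:
  fixes f :: "real \<Rightarrow> real"
  assumes "0 < b" "y \<in> {0..b}"
    and "(f has_real_derivative D) (at y within {0..b})"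
    and "(f has_real_derivative D') (at y within {0..b})"
  shows "D = D'"
  using assms vector_derivative_unique_within_closed_interval[of 0 b y f D D']
  by (simp add: has_real_derivative_iff_has_vector_derivative)

text \<open>
  The partial derivatives are defined by a choice of derivative within the closed domain, so they are
  meaningful only if that derivative is unique. At a strict crest no horizontal segment stays in the
  domain; the second direction is taken along a curve instead.
\<close>

lemma closed_fluid_derivative_unique:
  fixes f :: "real \<times> real \<Rightarrow> real"
  assumes \<eta>: "\<And>x. 0 < \<eta> x" "\<And>x. \<eta> differentiable (at x)"
    and z: "z \<in> closed_fluid \<eta>"
    and 1: "(f has_derivative (\<lambda>(h, k). a * h + b * k)) (at z within closed_fluid \<eta>)"
    and 2: "(f has_derivative (\<lambda>(h, k). a' * h + b' * k)) (at z within closed_fluid \<eta>)"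
  shows "a = a'" and "b = b'"
proof -
  obtain x y where xy: "z = (x, y)" by (cases z)
  have y: "y \<in> {0..\<eta> x}" using z by (auto simp: xy closed_fluid_def)
  have vert: "((\<lambda>t. f (x, t)) has_real_derivative b) (at y within {0..\<eta> x})"
    if "(f has_derivative (\<lambda>(h, k). a * h + b * k)) (at z within closed_fluid \<eta>)" for a b
  proof -
    have "((\<lambda>t. f (x, t)) has_real_derivative a * 0 + b * 1) (at y within {0..\<eta> x})"
      using that unfolding xy
      by (rule has_real_derivative_along[where p = "\<lambda>_. x" and q = "\<lambda>t. t"]) (simp_all add: closed_fluid_def)
    thus ?thesis by simp
  qed
  show b: "b = b'"
    by (rule has_real_derivative_unique_Icc[OF \<eta>(1)[of x] y vert[OF 1] vert[OF 2]])
  obtain \<eta>' where \<eta>': "(\<eta> has_real_derivative \<eta>') (at x)"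
    using \<eta>(2)[of x] real_differentiable_def by blast
  (* the curve through z on which y is a fixed fraction of the depth stays in the fluid *)
  have curve: "((\<lambda>t. f (t, y / \<eta> x * \<eta> t)) has_real_derivative a * 1 + b * (y / \<eta> x * \<eta>')) (at x)"
    if "(f has_derivative (\<lambda>(h, k). a * h + b * k)) (at z within closed_fluid \<eta>)" for a b
  proof (rule has_real_derivative_along)
    have "y / \<eta> x * \<eta> x = y"
      using \<eta>(1)[of x] by (simp add: less_le)
    with that show "(f has_derivative (\<lambda>(h, k). a * h + b * k)) (at (x, y / \<eta> x * \<eta> x) within closed_fluid \<eta>)"
      by (simp only: xy)
    show "((\<lambda>t. y / \<eta> x * \<eta> t) has_real_derivative y / \<eta> x * \<eta>') (at x)"
      by (rule DERIV_cmult[OF \<eta>'])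
    have frac: "0 \<le> y / \<eta> x" "y / \<eta> x \<le> 1" using y \<eta>(1)[of x] by auto
    show "(t, y / \<eta> x * \<eta> t) \<in> closed_fluid \<eta>" for t
      using mult_right_mono[OF frac(1), of "\<eta> t"] mult_right_mono[OF frac(2), of "\<eta> t"] \<eta>(1)[of t]
      by (simp add: closed_fluid_def)
  qed (rule DERIV_ident)
  show "a = a'" using DERIV_unique[OF curve[OF 1] curve[OF 2]] unfolding b by linarith
qed

text \<open>
  The array \<open>P\<close> of partial derivatives is a witness for smoothness of \<open>\<psi>\<close> up to the boundary. Fixing it
  turns all differential identities into algebra between its entries.
\<close>

locale unidirectional_flow =
  fixes \<gamma> :: real and \<eta> :: "real \<Rightarrow> real" and \<psi> :: "real \<times> real \<Rightarrow> real" and r :: real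
    and P :: "nat \<Rightarrow> nat \<Rightarrow> real \<times> real \<Rightarrow> real"
  assumes gamma_pos: "0 < \<gamma>"
    and wave: "wave_solution \<gamma> \<eta> \<psi> r"
    and uni: "unidirectional \<eta> \<psi>"
    and P0: "P 0 0 = \<psi>"
    and P_deriv: "z \<in> closed_fluid \<eta> \<Longrightarrow>
      (P i j has_derivative (\<lambda>(h, k). P (Suc i) j z * h + P i (Suc j) z * k))
        (at z within closed_fluid \<eta>)"
begin

abbreviation "S \<equiv> closed_fluid \<eta>"
abbreviation "\<psi>x \<equiv> P (Suc 0) 0"
abbreviation "\<psi>y \<equiv> P 0 (Suc 0)"
abbreviation "\<psi>xx \<equiv> P (Suc (Suc 0)) 0"
abbreviation "\<psi>xy \<equiv> P (Suc 0) (Suc 0)"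
abbreviation "\<psi>yy \<equiv> P 0 (Suc (Suc 0))"
abbreviation "\<eta>' \<equiv> deriv \<eta>"

lemmas wave_conditions = wave[unfolded wave_solution_def, THEN conjunct2]
  wave[unfolded wave_solution_def, THEN conjunct1]

lemma eta_pos: "0 < \<eta> x"
  using wave_conditions(2) by (rule spec)

lemma eta_deriv: "(\<eta> has_real_derivative \<eta>' x) (at x)"
proof -
  have "smooth_real \<eta>" using wave_conditions(1) by (rule conjunct1)
  from this[unfolded smooth_real_def, rule_format, of 0 x]
  have "\<eta> differentiable (at x)" by (simp only: funpow_0)
  thus ?thesis by (rule DERIV_deriv_iff_real_differentiable[THEN iffD2])
qed

lemma eta_cont: "continuous_on A \<eta>"
  by (intro continuous_at_imp_continuous_on ballI DERIV_isCont[OF eta_deriv])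

lemma eta_differentiable: "\<eta> differentiable (at x)"
  unfolding real_differentiable_def by (rule exI, rule eta_deriv)

lemma S_iff: "(x, y) \<in> S \<longleftrightarrow> 0 \<le> y \<and> y \<le> \<eta> x"
  by (simp add: closed_fluid_def)

lemma surface_in_S: "(x, \<eta> x) \<in> S" and bottom_in_S: "(x, 0) \<in> S"
  using eta_pos[of x] by (auto simp: S_iff)

lemma fluid_subset: "fluid \<eta> \<subseteq> S"
  by (auto simp: fluid_def closed_fluid_def)

text \<open>
  The chosen partial derivatives are the ones in the array \<open>P\<close>. Since only the values of \<open>f\<close> on the
  domain enter, the lemma can be applied twice and covers second derivatives.
\<close>

lemma frechet_derivative_P:
  assumes z: "z \<in> S" and f: "\<And>w. w \<in> S \<Longrightarrow> f w = P i j w"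
  shows "pdx S f z = P (Suc i) j z" and "pdy S f z = P i (Suc j) z"
proof -
  have d: "(f has_derivative (\<lambda>(h, k). P (Suc i) j z * h + P i (Suc j) z * k)) (at z within S)"
    by (rule has_derivative_transform[OF z f P_deriv[OF z]])
  hence "f differentiable (at z within S)" by (rule differentiableI)
  hence "(f has_derivative frechet_derivative f (at z within S)) (at z within S)"
    by (simp add: frechet_derivative_works)
  note D = has_derivative_pair_coefficients[OF this]
  note unique = closed_fluid_derivative_unique[OF eta_pos eta_differentiable z D d]
  show "pdx S f z = P (Suc i) j z" unfolding pdx_def by (rule unique(1))
  show "pdy S f z = P i (Suc j) z" unfolding pdy_def by (rule unique(2))
qed

lemma velocity: "z \<in> S \<Longrightarrow> velocity S \<psi> z = (\<psi>y z, - \<psi>x z)"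
  unfolding velocity_def using frechet_derivative_P[of z \<psi> 0 0] P0 by metis

lemma u_pos: "z \<in> S \<Longrightarrow> 0 < \<psi>y z"
  using uni velocity[of z] unfolding unidirectional_def by (metis fst_conv)

lemma poisson: "z \<in> fluid \<eta> \<Longrightarrow> \<psi>xx z + \<psi>yy z = \<gamma>"
proof -
  assume z: "z \<in> fluid \<eta>"
  have d: "pdx S \<psi> w = \<psi>x w" "pdy S \<psi> w = \<psi>y w" if "w \<in> S" for w
    using frechet_derivative_P[of w \<psi> 0 0] that P0 by metis+
  have "z \<in> S" using z fluid_subset by blast
  have "laplacian S \<psi> z = \<psi>xx z + \<psi>yy z"
    unfolding laplacian_def
    using frechet_derivative_P(1)[OF \<open>z \<in> S\<close> d(1)] frechet_derivative_P(2)[OF \<open>z \<in> S\<close> d(2)] by simp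
  thus ?thesis using wave z by (simp add: wave_solution_def)
qed

lemma bernoulli: "((\<psi>x (x, \<eta> x))\<^sup>2 + (\<psi>y (x, \<eta> x))\<^sup>2) / 2 + \<eta> x = r"
  using wave frechet_derivative_P[OF surface_in_S, of \<psi> 0 0 x] P0
  unfolding wave_solution_def by metis

lemma psi_surface: "\<psi> (x, \<eta> x) = 1" and psi_bottom: "\<psi> (x, 0) = 0"
  using wave by (simp_all add: wave_solution_def)

lemma P_cont: "continuous_on S (P i j)"
  by (rule has_derivative_continuous_on[OF P_deriv])

lemma P_dy: "(x, y) \<in> S \<Longrightarrow> ((\<lambda>t. P i j (x, t)) has_real_derivative P i (Suc j) (x, y)) (at y within {0..\<eta> x})"
  using has_real_derivative_along[OF P_deriv, of "\<lambda>_. x" y "\<lambda>t. t" 0 "{0..\<eta> x}" 1 i j]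
  by (simp add: S_iff)

lemma P_deriv_interior:
  assumes "z \<in> fluid \<eta>"
  shows "(P i j has_derivative (\<lambda>(h, k). P (Suc i) j z * h + P i (Suc j) z * k)) (at z)"
proof -
  have "at z within S = at z"
    by (rule at_within_open_subset[OF assms open_fluid[OF eta_cont] fluid_subset])
  thus ?thesis using P_deriv[of z i j] assms fluid_subset by auto
qed

lemma P_dx_fluid: "(x, y) \<in> fluid \<eta> \<Longrightarrow> ((\<lambda>t. P i j (t, y)) has_real_derivative P (Suc i) j (x, y)) (at x)"
  using has_real_derivative_along[OF P_deriv_interior, of "\<lambda>t. t" x "\<lambda>_. y" 1 UNIV 0 i j] by simp

lemma P_dy_fluid: "(x, y) \<in> fluid \<eta> \<Longrightarrow> ((\<lambda>t. P i j (x, t)) has_real_derivative P i (Suc j) (x, y)) (at y)"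
  using has_real_derivative_along[OF P_deriv_interior, of "\<lambda>_. x" y "\<lambda>t. t" 0 UNIV 1 i j] by simp

lemma P_surface: "((\<lambda>t. P i j (t, \<eta> t)) has_real_derivative
    P (Suc i) j (x, \<eta> x) + P i (Suc j) (x, \<eta> x) * \<eta>' x) (at x)"
  using has_real_derivative_along[where p = "\<lambda>t. t" and q = \<eta>,
      OF P_deriv[OF surface_in_S] DERIV_ident eta_deriv surface_in_S, of i j x]
  by simp

lemma P_bottom: "((\<lambda>t. P i j (t, 0)) has_real_derivative P (Suc i) j (x, 0)) (at x)"
  using has_real_derivative_along[where p = "\<lambda>t. t" and q = "\<lambda>_. 0",
      OF P_deriv[OF bottom_in_S] DERIV_ident DERIV_const bottom_in_S, of i j x]
  by simp

lemma poisson_closed: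
  assumes "z \<in> S" shows "\<psi>xx z + \<psi>yy z = \<gamma>"
proof -
  obtain x y where xy: "z = (x, y)" by (cases z)
  have y: "y \<in> closure {0<..<\<eta> x}" using assms eta_pos[of x] by (simp add: xy S_iff)
  have "continuous_on {0..\<eta> x} (\<lambda>t. \<psi>xx (x, t) + \<psi>yy (x, t))"
    by (intro continuous_intros continuous_on_compose2[OF P_cont]) (auto simp: S_iff)
  hence cont: "continuous_on (closure {0<..<\<eta> x}) (\<lambda>t. \<psi>xx (x, t) + \<psi>yy (x, t))"
    using eta_pos[of x] by simp
  have "(x, t) \<in> fluid \<eta>" if "t \<in> {0<..<\<eta> x}" for t
    using that by (simp add: fluid_def)
  from continuous_constant_on_closure[OF cont poisson[OF this] y]
  show ?thesis unfolding xy by assumption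
qed

lemma poisson_dx: "(x, y) \<in> fluid \<eta> \<Longrightarrow> P (Suc (Suc (Suc 0))) 0 (x, y) + P (Suc 0) (Suc (Suc 0)) (x, y) = 0"
  and poisson_dy: "(x, y) \<in> fluid \<eta> \<Longrightarrow> P (Suc (Suc 0)) (Suc 0) (x, y) + P 0 (Suc (Suc (Suc 0))) (x, y) = 0"
proof -
  assume z: "(x, y) \<in> fluid \<eta>"
  let ?f = "\<lambda>z. \<psi>xx z + \<psi>yy z"
  have "(?f has_derivative (\<lambda>_. 0)) (at (x, y))"
    using open_fluid[OF eta_cont] z
    by (rule has_derivative_transform_within_open[OF has_derivative_const[of \<gamma>]]) (simp add: poisson)
  moreover have "(?f has_derivative (\<lambda>(h, k). (P (Suc (Suc (Suc 0))) 0 (x, y) + P (Suc 0) (Suc (Suc 0)) (x, y)) * h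
      + (P (Suc (Suc 0)) (Suc 0) (x, y) + P 0 (Suc (Suc (Suc 0))) (x, y)) * k)) (at (x, y))"
    using has_derivative_add[OF P_deriv_interior[OF z, of "Suc (Suc 0)" 0] P_deriv_interior[OF z, of 0 "Suc (Suc 0)"]]
    by (simp add: case_prod_unfold algebra_simps)
  ultimately have "(\<lambda>(h, k). (P (Suc (Suc (Suc 0))) 0 (x, y) + P (Suc 0) (Suc (Suc 0)) (x, y)) * h
      + (P (Suc (Suc 0)) (Suc 0) (x, y) + P 0 (Suc (Suc (Suc 0))) (x, y)) * k) = (\<lambda>_. 0)"
    by (rule has_derivative_unique[symmetric])
  from fun_cong[OF this, of "(1, 0)"] fun_cong[OF this, of "(0, 1)"]
  show "P (Suc (Suc (Suc 0))) 0 (x, y) + P (Suc 0) (Suc (Suc 0)) (x, y) = 0"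
    and "P (Suc (Suc 0)) (Suc 0) (x, y) + P 0 (Suc (Suc (Suc 0))) (x, y) = 0" by simp_all
qed

lemma psi_x_bottom: "\<psi>x (x, 0) = 0"
proof -
  have "((\<lambda>t. P 0 0 (t, 0)) has_real_derivative 0) (at x)" by (simp add: P0 psi_bottom)
  from DERIV_unique[OF this P_bottom] show ?thesis by simp
qed

lemma psi_xx_bottom: "\<psi>xx (x, 0) = 0"
proof -
  have "((\<lambda>t. \<psi>x (t, 0)) has_real_derivative 0) (at x)" by (simp add: psi_x_bottom)
  from DERIV_unique[OF this P_bottom] show ?thesis by simp
qed

lemma psi_yy_bottom: "\<psi>yy (x, 0) = \<gamma>"
  using poisson_closed[OF bottom_in_S, of x] psi_xx_bottom by simp

lemma kinematic: "\<psi>x (x, \<eta> x) = - \<eta>' x * \<psi>y (x, \<eta> x)"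
proof -
  have "((\<lambda>t. P 0 0 (t, \<eta> t)) has_real_derivative 0) (at x)" by (simp add: P0 psi_surface)
  from DERIV_unique[OF this P_surface] show ?thesis by (simp add: algebra_simps)
qed

lemma psi_mono: "0 \<le> a \<Longrightarrow> a \<le> b \<Longrightarrow> b \<le> \<eta> x \<Longrightarrow> \<psi> (x, a) \<le> \<psi> (x, b)"
proof -
  assume ab: "0 \<le> a" "a \<le> b" "b \<le> \<eta> x"
  show "\<psi> (x, a) \<le> \<psi> (x, b)"
  proof (rule DERIV_nonneg_imp_increasing_open[OF ab(2)])
    fix t assume "a < t" "t < b"
    hence z: "(x, t) \<in> fluid \<eta>" using ab by (auto simp: fluid_def)
    hence "0 < \<psi>y (x, t)" using fluid_subset by (intro u_pos) blast
    thus "\<exists>y. ((\<lambda>t. \<psi> (x, t)) has_real_derivative y) (at t) \<and> 0 \<le> y"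
      using P_dy_fluid[OF z, of 0 0] unfolding P0 by (meson less_imp_le)
  next
    show "continuous_on {a..b} (\<lambda>t. \<psi> (x, t))"
      using ab unfolding P0[symmetric]
      by (intro continuous_on_compose2[OF P_cont]) (auto intro!: continuous_intros simp: S_iff)
  qed
qed

lemma psi_le_1: "z \<in> S \<Longrightarrow> \<psi> z \<le> 1"
  using psi_mono[of "snd z" "\<eta> (fst z)" "fst z"] psi_surface[of "fst z"] 
  by (cases z) (auto simp: S_iff)

lemma psi_nonneg: "z \<in> S \<Longrightarrow> 0 \<le> \<psi> z"
  using psi_mono[of 0 "snd z" "fst z"] psi_bottom[of "fst z"] 
  by (cases z) (auto simp: S_iff)

end

section \<open>Functions on the line\<close>

lemma periodic_value_in_Icc:
  fixes f :: "real \<Rightarrow> 'a"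
  assumes "0 < L" and per: "\<And>x. f (x + L) = f x"
  obtains x' where "x' \<in> {0..L}" and "f x' = f x"
proof
  interpret periodic_fun_simple f L by unfold_locales (rule per)
  show "f (x - of_int \<lfloor>x / L\<rfloor> * L) = f x" by (rule minus_of_int)
  have "of_int \<lfloor>x / L\<rfloor> * L \<le> x" and "x \<le> (of_int \<lfloor>x / L\<rfloor> + 1) * L"
    using \<open>0 < L\<close> floor_divide_lower[of L x] floor_divide_upper[of L x] by auto
  thus "x - of_int \<lfloor>x / L\<rfloor> * L \<in> {0..L}" by (auto simp: algebra_simps)
qed

text \<open>
  Either condition at the ends makes the supremum, if it exceeds \<open>M\<close>, a maximum, hence a critical value.
\<close>

lemma le_at_critical_points_imp_le:
  fixes f :: "real \<Rightarrow> real"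
  assumes f: "\<And>x. (f has_real_derivative f' x) (at x)"
    and crit: "\<And>x. f' x = 0 \<Longrightarrow> f x \<le> M"
    and ends: "(\<exists>L>0. \<forall>x. f (x + L) = f x) \<or> (\<exists>l\<le>M. (f \<longlongrightarrow> l) at_infinity)"
  shows "f x \<le> M"
proof (rule ccontr)
  assume "\<not> f x \<le> M"
  have cont: "continuous_on A f" for A
    by (intro continuous_at_imp_continuous_on ballI DERIV_isCont[OF f])
  have "\<exists>m. (\<forall>y. f y \<le> f m)"
    using ends
  proof
    assume "\<exists>L>0. \<forall>x. f (x + L) = f x"
    then obtain L where L: "0 < L" "\<And>x. f (x + L) = f x" by blast
    obtain m where m: "\<And>y. y \<in> {0..L} \<Longrightarrow> f y \<le> f m"
      using continuous_attains_sup[OF compact_Icc _ cont, of 0 L] \<open>0 < L\<close>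
      by (metis atLeastAtMost_iff empty_iff order_refl less_imp_le)
    have "f y \<le> f m" for y
      using periodic_value_in_Icc[of L f y] L m by metis
    thus ?thesis by blast
  next
    assume "\<exists>l\<le>M. (f \<longlongrightarrow> l) at_infinity"
    then obtain l where "l \<le> M" and lim: "(f \<longlongrightarrow> l) at_infinity" by blast
    hence "l < f x" using \<open>\<not> f x \<le> M\<close> by linarith
    with lim have "\<forall>\<^sub>F y in at_infinity. f y < f x" by (intro order_tendstoD)
    then obtain X where X: "\<And>y. X \<le> \<bar>y\<bar> \<Longrightarrow> f y < f x"
      unfolding eventually_at_infinity by auto
    have x: "x \<in> {-X..X}" using X[of x] by fastforce
    obtain m where m: "\<And>y. y \<in> {-X..X} \<Longrightarrow> f y \<le> f m"
      using continuous_attains_sup[OF compact_Icc _ cont, of "-X" X] x by blast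
    have "f y \<le> f m" for y
    proof (cases "X \<le> \<bar>y\<bar>")
      case True
      thus ?thesis using X[of y] m[OF x] by linarith
    next
      case False
      thus ?thesis by (intro m) auto
    qed
    thus ?thesis by blast
  qed
  then obtain m where m: "\<And>y. f y \<le> f m" by blast
  have "f' m = 0" by (rule DERIV_local_max[OF f[of m], of 1]) (auto intro: m)
  from crit[OF this] m[of x] \<open>\<not> f x \<le> M\<close> show False by linarith
qed

lemma derivative_nonneg_at_right_max:
  fixes f :: "real \<Rightarrow> real"
  assumes "0 < b" and f: "(f has_real_derivative D) (at b within {0..b})"
    and max: "\<And>t. t \<in> {0..b} \<Longrightarrow> f t \<le> f b"
  shows "0 \<le> D"
proof (rule ccontr)
  assume "\<not> 0 \<le> D"
  then obtain d where "0 < d" and d: "\<And>h. 0 < h \<Longrightarrow> b - h \<in> {0..b} \<Longrightarrow> h < d \<Longrightarrow> f b < f (b - h)"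
    using has_real_derivative_neg_dec_left[OF f] by auto
  define h where "h = min (d / 2) b"
  have "0 < h" "h < d" "b - h \<in> {0..b}" using \<open>0 < d\<close> \<open>0 < b\<close> by (auto simp: h_def)
  with d[of h] max[of "b - h"] show False by linarith
qed

section \<open>Estimates for a single wave\<close>

context unidirectional_flow
begin

text \<open>
  With \<open>\<gamma> \<psi>\<close> in place of \<open>\<gamma> \<psi> / 2\<close> this would be minus the pressure, up to a constant. That
  function need not be subharmonic; halving the last term makes it so.
\<close>

definition head :: "real \<times> real \<Rightarrow> real" where
  "head z = ((\<psi>x z)\<^sup>2 + (\<psi>y z)\<^sup>2) / 2 + snd z - \<gamma> / 2 * P 0 0 z"

definition head_dy :: "real \<times> real \<Rightarrow> real" where
  "head_dy z = \<psi>x z * \<psi>xy z + \<psi>y z * \<psi>yy z + 1 - \<gamma> / 2 * \<psi>y z"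

lemma head_surface: "head (x, \<eta> x) = r - \<gamma> / 2"
  using bernoulli[of x] psi_surface[of x] by (simp add: head_def P0)

lemma head_has_derivative_vertical:
  assumes "(x, y) \<in> S"
  shows "((\<lambda>t. head (x, t)) has_real_derivative head_dy (x, y)) (at y within {0..\<eta> x})"
  unfolding head_def head_dy_def
  by (auto intro!: derivative_eq_intros P_dy[OF assms])

text \<open>
  With \<open>a = \<psi>\<^sub>x\<^sub>x\<close> and \<open>b = \<psi>\<^sub>y\<^sub>y\<close>, so that \<open>a + b = \<gamma>\<close>, the Laplacian of the head is
  \<open>a\<^sup>2 + b\<^sup>2 + 2 \<psi>\<^sub>x\<^sub>y\<^sup>2 - \<gamma>\<^sup>2 / 2 = (a - b)\<^sup>2 / 2 + 2 \<psi>\<^sub>x\<^sub>y\<^sup>2\<close>. At the bottom \<open>\<psi>\<^sub>x = 0\<close> and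
  \<open>\<psi>\<^sub>y\<^sub>y = \<gamma>\<close>, so the vertical derivative is \<open>1 + \<gamma> u / 2 > 0\<close> and the maximum lies on the surface.
\<close>

lemma head_le_surface:
  assumes H: "\<And>x. \<eta> x \<le> H"
    and B: "\<And>z. z \<in> S \<Longrightarrow> (\<psi>x z)\<^sup>2 + (\<psi>y z)\<^sup>2 \<le> B"
    and z: "z \<in> S"
  shows "head z \<le> r - \<gamma> / 2"
proof (rule fluid_max_principle[OF eta_cont eta_pos H _ _ _ _ _ _ _ _ _ z])
  let ?gx = "\<lambda>z. \<psi>x z * \<psi>xx z + \<psi>y z * \<psi>xy z - \<gamma> / 2 * \<psi>x z"
  let ?gxx = "\<lambda>z. (\<psi>xx z)\<^sup>2 + \<psi>x z * P (Suc (Suc (Suc 0))) 0 z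
    + (\<psi>xy z)\<^sup>2 + \<psi>y z * P (Suc (Suc 0)) (Suc 0) z - \<gamma> / 2 * \<psi>xx z"
  let ?gyy = "\<lambda>z. (\<psi>xy z)\<^sup>2 + \<psi>x z * P (Suc 0) (Suc (Suc 0)) z
    + (\<psi>yy z)\<^sup>2 + \<psi>y z * P 0 (Suc (Suc (Suc 0))) z - \<gamma> / 2 * \<psi>yy z"
  show "continuous_on S head"
    unfolding head_def by (intro continuous_intros P_cont) auto
  show "head w \<le> B / 2 + H" if "w \<in> S" for w
  proof -
    have "snd w \<le> H" using that H[of "fst w"] by (cases w) (auto simp: S_iff)
    moreover have "0 \<le> \<gamma> / 2 * \<psi> w" using gamma_pos psi_nonneg[OF that] by simp
    ultimately show ?thesis using B[OF that] unfolding head_def P0 by argo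
  qed
  show "((\<lambda>t. head (t, y)) has_real_derivative ?gx (x, y)) (at x)" if "(x, y) \<in> fluid \<eta>" for x y
    unfolding head_def
    by (auto intro!: derivative_eq_intros P_dx_fluid[OF that])
  show "((\<lambda>t. ?gx (t, y)) has_real_derivative ?gxx (x, y)) (at x)" if "(x, y) \<in> fluid \<eta>" for x y
    by (auto intro!: derivative_eq_intros P_dx_fluid[OF that] simp: power2_eq_square)
  show "((\<lambda>t. head (x, t)) has_real_derivative head_dy (x, y)) (at y)" if "(x, y) \<in> fluid \<eta>" for x y
    unfolding head_def head_dy_def
    by (auto intro!: derivative_eq_intros P_dy_fluid[OF that])
  show "((\<lambda>t. head_dy (x, t)) has_real_derivative ?gyy (x, y)) (at y)" if "(x, y) \<in> fluid \<eta>" for x y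
    unfolding head_dy_def
    by (auto intro!: derivative_eq_intros P_dy_fluid[OF that] simp: power2_eq_square)
  show "0 \<le> ?gxx z + ?gyy z" if "z \<in> fluid \<eta>" for z
  proof -
    obtain x y where xy: "z = (x, y)" by (cases z)
    define a b where "a = \<psi>xx z" and "b = \<psi>yy z"
    have ab: "\<gamma> = a + b" using poisson[OF that] by (simp add: a_def b_def)
    have "?gxx z + ?gyy z = a\<^sup>2 + b\<^sup>2 + 2 * (\<psi>xy z)\<^sup>2
      + \<psi>x z * (P (Suc (Suc (Suc 0))) 0 z + P (Suc 0) (Suc (Suc 0)) z)
      + \<psi>y z * (P (Suc (Suc 0)) (Suc 0) z + P 0 (Suc (Suc (Suc 0))) z) - \<gamma> / 2 * (a + b)"
      unfolding a_def b_def by (simp add: algebra_simps)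
    also have "\<dots> = (a - b)\<^sup>2 / 2 + 2 * (\<psi>xy z)\<^sup>2"
      using poisson_dx[of x y] poisson_dy[of x y] that
      unfolding ab xy by (simp add: field_simps power2_eq_square)
    finally have eq: "?gxx z + ?gyy z = (a - b)\<^sup>2 / 2 + 2 * (\<psi>xy z)\<^sup>2" .
    show ?thesis unfolding eq by simp
  qed
  show "head (x, \<eta> x) \<le> r - \<gamma> / 2" for x using head_surface[of x] by simp
  show "head (x, 0) \<le> r - \<gamma> / 2 \<or>
       (\<exists>b>0. ((\<lambda>t. head (x, t)) has_real_derivative b) (at 0 within {0..\<eta> x}))" for x
  proof (intro disjI2 exI conjI)
    show "((\<lambda>t. head (x, t)) has_real_derivative head_dy (x, 0)) (at 0 within {0..\<eta> x})"
      by (rule head_has_derivative_vertical[OF bottom_in_S])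
    have "head_dy (x, 0) = \<gamma> / 2 * \<psi>y (x, 0) + 1"
      unfolding head_dy_def psi_x_bottom psi_yy_bottom by (simp add: algebra_simps)
    moreover have "0 < \<gamma> / 2 * \<psi>y (x, 0)" using gamma_pos u_pos[OF bottom_in_S] by simp
    ultimately show "0 < head_dy (x, 0)" by linarith
  qed
qed

lemma head_dy_surface_nonneg:
  assumes "\<And>x. \<eta> x \<le> H" and "\<And>z. z \<in> S \<Longrightarrow> (\<psi>x z)\<^sup>2 + (\<psi>y z)\<^sup>2 \<le> B"
  shows "0 \<le> head_dy (x, \<eta> x)"
proof (rule derivative_nonneg_at_right_max[OF eta_pos head_has_derivative_vertical[OF surface_in_S]])
  fix t assume "t \<in> {0..\<eta> x}"
  hence "(x, t) \<in> S" by (simp add: S_iff)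
  from head_le_surface[OF assms this] show "head (x, t) \<le> head (x, \<eta> x)" by (simp add: head_surface)
qed

definition surplus :: "real \<Rightarrow> real" where
  "surplus x = \<psi>y (x, \<eta> x) - \<gamma> / 2 * \<eta> x"

text \<open>
  Differentiating Bernoulli's law along the surface and eliminating \<open>\<psi>\<^sub>x = - \<eta>' u\<close> and
  \<open>\<psi>\<^sub>x\<^sub>x = \<gamma> - \<psi>\<^sub>y\<^sub>y\<close> leaves a multiple of \<open>\<eta>'\<close>. Once the head is known to increase upwards at the
  surface, the surplus cannot grow where the surface rises.
\<close>

lemma surplus_deriv: "(surplus has_real_derivative - \<eta>' x * (head_dy (x, \<eta> x) / \<psi>y (x, \<eta> x))) (at x)"
proof -
  let ?z = "(x, \<eta> x)"
  have u: "0 < \<psi>y ?z" by (rule u_pos[OF surface_in_S])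
  have "((\<lambda>t. ((\<psi>x (t, \<eta> t))\<^sup>2 + (\<psi>y (t, \<eta> t))\<^sup>2) / 2 + \<eta> t) has_real_derivative
      \<psi>x ?z * (\<psi>xx ?z + \<psi>xy ?z * \<eta>' x) + \<psi>y ?z * (\<psi>xy ?z + \<psi>yy ?z * \<eta>' x) + \<eta>' x) (at x)"
    by (auto intro!: derivative_eq_intros P_surface eta_deriv)
  hence *: "\<psi>x ?z * (\<psi>xx ?z + \<psi>xy ?z * \<eta>' x) + \<psi>y ?z * (\<psi>xy ?z + \<psi>yy ?z * \<eta>' x) + \<eta>' x = 0"
    unfolding bernoulli using DERIV_unique DERIV_const by blast
  have xx: "\<psi>xx ?z = \<gamma> - \<psi>yy ?z" using poisson_closed[OF surface_in_S, of x] by linarith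
  have "\<psi>y ?z * (\<psi>xy ?z + \<psi>yy ?z * \<eta>' x - \<gamma> / 2 * \<eta>' x) = - \<eta>' x * head_dy ?z"
    using * unfolding head_dy_def xx kinematic by (simp add: algebra_simps)
  hence "\<psi>xy ?z + \<psi>yy ?z * \<eta>' x - \<gamma> / 2 * \<eta>' x = - \<eta>' x * (head_dy ?z / \<psi>y ?z)"
    using u by (simp add: field_simps)
  moreover have "(surplus has_real_derivative \<psi>xy ?z + \<psi>yy ?z * \<eta>' x - \<gamma> / 2 * \<eta>' x) (at x)"
    unfolding surplus_def by (auto intro!: derivative_eq_intros P_surface eta_deriv)
  ultimately show ?thesis by simp
qed

lemma crest_velocity:
  assumes crest: "\<And>x. \<eta> x \<le> \<eta> 0"
  shows "(\<psi>y (0, \<eta> 0))\<^sup>2 = 2 * (r - \<eta> 0)"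
proof -
  have "\<eta>' 0 = 0" by (rule DERIV_local_max[OF eta_deriv, of 1]) (auto intro: crest)
  thus ?thesis using bernoulli[of 0] kinematic[of 0] by simp
qed

text \<open>
  The maximum principle gives only \<open>head_dy \<ge> 0\<close> on the surface, so a critical point of the surplus need
  not be one of \<open>\<eta>\<close>. Subtracting \<open>\<epsilon> \<eta>\<close> repairs this: the derivative becomes \<open>\<eta>'\<close> times a negative
  number. At points with \<open>\<eta>' = 0\<close>, and in the limit at infinity, \<open>u\<^sup>2 = 2 (r - \<eta>)\<close>, and the surplus is
  smallest where \<open>\<eta>\<close> is largest. Finally \<open>\<epsilon>\<close> tends to zero.
\<close>

lemma surplus_ge_crest:
  assumes crest: "\<And>x. \<eta> x \<le> \<eta> 0"
    and B: "\<And>z. z \<in> S \<Longrightarrow> (\<psi>x z)\<^sup>2 + (\<psi>y z)\<^sup>2 \<le> B"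
    and ends: "(\<exists>L>0. \<forall>x. \<eta> (x + L) = \<eta> x \<and> \<psi>y (x + L, \<eta> (x + L)) = \<psi>y (x, \<eta> x)) \<or>
      (\<exists>d U. (\<eta> \<longlongrightarrow> d) at_infinity \<and> ((\<lambda>x. \<psi>y (x, \<eta> x)) \<longlongrightarrow> U) at_infinity \<and> U\<^sup>2 / 2 + d = r)"
  shows "surplus 0 \<le> surplus x"
proof -
  have main: "\<epsilon> * \<eta> x - surplus x \<le> \<epsilon> * \<eta> 0 - surplus 0" if "0 < \<epsilon>" for \<epsilon>
  proof (rule le_at_critical_points_imp_le[where f = "\<lambda>x. \<epsilon> * \<eta> x - surplus x"])
    let ?k = "\<lambda>x. head_dy (x, \<eta> x) / \<psi>y (x, \<eta> x)"
    show "((\<lambda>x. \<epsilon> * \<eta> x - surplus x) has_real_derivative \<eta>' x * (\<epsilon> + ?k x)) (at x)" for x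
      by (rule DERIV_cong[OF DERIV_diff[OF DERIV_cmult[OF eta_deriv] surplus_deriv]]) (simp add: algebra_simps)
    have *: "\<epsilon> * d - (U - \<gamma> / 2 * d) \<le> \<epsilon> * \<eta> 0 - surplus 0"
      if "d \<le> \<eta> 0" "0 \<le> U" "U\<^sup>2 = 2 * (r - d)" for d U
    proof -
      have "(\<psi>y (0, \<eta> 0))\<^sup>2 \<le> U\<^sup>2" using crest_velocity[OF crest] that by simp
      hence "\<psi>y (0, \<eta> 0) \<le> U" using \<open>0 \<le> U\<close> by (rule power2_le_imp_le)
      moreover have "\<epsilon> * d \<le> \<epsilon> * \<eta> 0" "\<gamma> / 2 * d \<le> \<gamma> / 2 * \<eta> 0"
        using that \<open>0 < \<epsilon>\<close> gamma_pos by (auto intro!: mult_left_mono)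
      ultimately show ?thesis unfolding surplus_def by linarith
    qed
    show "\<epsilon> * \<eta> x - surplus x \<le> \<epsilon> * \<eta> 0 - surplus 0" if "\<eta>' x * (\<epsilon> + ?k x) = 0" for x
    proof -
      have "0 \<le> ?k x"
        using head_dy_surface_nonneg[OF crest B] u_pos[OF surface_in_S, of x] by (intro divide_nonneg_pos)
      hence "\<eta>' x = 0" using that \<open>0 < \<epsilon>\<close> by auto
      hence "(\<psi>y (x, \<eta> x))\<^sup>2 = 2 * (r - \<eta> x)" using bernoulli[of x] kinematic[of x] by simp
      with *[OF crest less_imp_le[OF u_pos[OF surface_in_S]]] show ?thesis by (simp add: surplus_def)
    qed
    show "(\<exists>L>0. \<forall>x. \<epsilon> * \<eta> (x + L) - surplus (x + L) = \<epsilon> * \<eta> x - surplus x) \<or>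
        (\<exists>l\<le>\<epsilon> * \<eta> 0 - surplus 0. ((\<lambda>x. \<epsilon> * \<eta> x - surplus x) \<longlongrightarrow> l) at_infinity)"
      using ends
    proof
      assume "\<exists>L>0. \<forall>x. \<eta> (x + L) = \<eta> x \<and> \<psi>y (x + L, \<eta> (x + L)) = \<psi>y (x, \<eta> x)"
      then obtain L where "0 < L" "\<And>x. \<eta> (x + L) = \<eta> x" "\<And>x. \<psi>y (x + L, \<eta> (x + L)) = \<psi>y (x, \<eta> x)"
        by blast
      thus ?thesis unfolding surplus_def by (intro disjI1 exI[of _ L]) simp
    next
      assume "\<exists>d U. (\<eta> \<longlongrightarrow> d) at_infinity \<and> ((\<lambda>x. \<psi>y (x, \<eta> x)) \<longlongrightarrow> U) at_infinity \<and> U\<^sup>2 / 2 + d = r"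
      then obtain d U where d: "(\<eta> \<longlongrightarrow> d) at_infinity"
        and U: "((\<lambda>x. \<psi>y (x, \<eta> x)) \<longlongrightarrow> U) at_infinity" and dU: "U\<^sup>2 / 2 + d = r" by blast
      have "d \<le> \<eta> 0" by (rule tendsto_upperbound[OF d]) (auto simp: crest trivial_limit_at_infinity)
      moreover have "0 \<le> U"
        by (rule tendsto_lowerbound[OF U]) (auto simp: trivial_limit_at_infinity intro!: always_eventually less_imp_le u_pos surface_in_S)
      ultimately have "\<epsilon> * d - (U - \<gamma> / 2 * d) \<le> \<epsilon> * \<eta> 0 - surplus 0" using dU by (intro *) auto
      moreover have "((\<lambda>x. \<epsilon> * \<eta> x - surplus x) \<longlongrightarrow> \<epsilon> * d - (U - \<gamma> / 2 * d)) at_infinity"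
        unfolding surplus_def by (intro tendsto_intros d U)
      ultimately show ?thesis by blast
    qed
  qed
  show ?thesis
  proof (rule field_le_epsilon)
    fix e :: real assume "0 < e"
    define \<epsilon> where "\<epsilon> = e / \<eta> 0"
    have "0 < \<epsilon>" using \<open>0 < e\<close> eta_pos by (simp add: \<epsilon>_def)
    from main[OF this] have "surplus 0 \<le> surplus x + \<epsilon> * \<eta> 0 - \<epsilon> * \<eta> x" by linarith
    moreover have "\<epsilon> * \<eta> 0 = e" using eta_pos[of 0] by (simp add: \<epsilon>_def)
    moreover have "0 < \<epsilon> * \<eta> x" using \<open>0 < \<epsilon>\<close> eta_pos by simp
    ultimately show "surplus 0 \<le> surplus x + e" by linarith
  qed
qed

text \<open>
  The function \<open>\<gamma> y / 2 - u\<close> is harmonic. On the surface it is nonpositive by assumption, at the bottom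
  because the flow is unidirectional.
\<close>

lemma u_ge_in_fluid:
  assumes H: "\<And>x. \<eta> x \<le> H"
    and surplus: "\<And>x. 0 \<le> surplus x"
    and z: "z \<in> S"
  shows "\<gamma> / 2 * snd z \<le> \<psi>y z"
proof -
  have "\<gamma> / 2 * snd z - \<psi>y z \<le> 0"
  proof (rule fluid_max_principle[OF eta_cont eta_pos H _ _ _ _ _ _ _ _ _ z])
    show "continuous_on S (\<lambda>z. \<gamma> / 2 * snd z - \<psi>y z)" by (intro continuous_intros P_cont)
    show "\<gamma> / 2 * snd w - \<psi>y w \<le> \<gamma> / 2 * H" if "w \<in> S" for w
    proof -
      have "snd w \<le> H" using that H[of "fst w"] by (cases w) (auto simp: S_iff)
      hence "\<gamma> / 2 * snd w \<le> \<gamma> / 2 * H" using gamma_pos by (intro mult_left_mono) auto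
      thus ?thesis using u_pos[OF that] by linarith
    qed
    show "((\<lambda>t. \<gamma> / 2 * snd (t, y) - \<psi>y (t, y)) has_real_derivative - \<psi>xy (x, y)) (at x)"
      if "(x, y) \<in> fluid \<eta>" for x y
      by (auto intro!: derivative_eq_intros P_dx_fluid[OF that])
    show "((\<lambda>t. - \<psi>xy (t, y)) has_real_derivative - P (Suc (Suc 0)) (Suc 0) (x, y)) (at x)"
      if "(x, y) \<in> fluid \<eta>" for x y
      by (auto intro!: derivative_eq_intros P_dx_fluid[OF that])
    show "((\<lambda>t. \<gamma> / 2 * snd (x, t) - \<psi>y (x, t)) has_real_derivative \<gamma> / 2 - \<psi>yy (x, y)) (at y)"
      if "(x, y) \<in> fluid \<eta>" for x y
      by (auto intro!: derivative_eq_intros P_dy_fluid[OF that])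
    show "((\<lambda>t. \<gamma> / 2 - \<psi>yy (x, t)) has_real_derivative - P 0 (Suc (Suc (Suc 0))) (x, y)) (at y)"
      if "(x, y) \<in> fluid \<eta>" for x y
      by (auto intro!: derivative_eq_intros P_dy_fluid[OF that])
    show "0 \<le> - P (Suc (Suc 0)) (Suc 0) z + - P 0 (Suc (Suc (Suc 0))) z" if "z \<in> fluid \<eta>" for z
      using poisson_dy[of "fst z" "snd z"] that by simp
    show "\<gamma> / 2 * snd (x, \<eta> x) - \<psi>y (x, \<eta> x) \<le> 0" for x
      using surplus[of x] by (simp add: surplus_def)
    show "\<gamma> / 2 * snd (x, 0) - \<psi>y (x, 0) \<le> 0 \<or> (\<exists>b>0. ((\<lambda>t. \<gamma> / 2 * snd (x, t) - \<psi>y (x, t))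
        has_real_derivative b) (at 0 within {0..\<eta> x}))" for x
      using u_pos[OF bottom_in_S, of x] by (intro disjI1) simp
  qed
  thus ?thesis by simp
qed

text \<open>
  Integrate \<open>\<psi>\<^sub>y \<ge> \<gamma> y / 2\<close> from the bottom, where \<open>\<psi> = 0\<close>, to the surface, where \<open>\<psi> = 1\<close>.
\<close>

lemma depth_bound:
  assumes H: "\<And>x. \<eta> x \<le> H" and surplus: "\<And>x. 0 \<le> surplus x"
  shows "\<gamma> * (\<eta> x)\<^sup>2 \<le> 4"
proof -
  have "P 0 0 (x, 0) - \<gamma> / 4 * 0\<^sup>2 \<le> P 0 0 (x, \<eta> x) - \<gamma> / 4 * (\<eta> x)\<^sup>2"
  proof (rule DERIV_nonneg_imp_increasing_open[OF less_imp_le[OF eta_pos]])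
    fix t assume "0 < t" "t < \<eta> x"
    hence z: "(x, t) \<in> fluid \<eta>" by (simp add: fluid_def)
    have "((\<lambda>t. P 0 0 (x, t) - \<gamma> / 4 * t\<^sup>2) has_real_derivative \<psi>y (x, t) - \<gamma> / 2 * t) (at t)"
      by (auto intro!: derivative_eq_intros P_dy_fluid[OF z])
    moreover have "\<gamma> / 2 * t \<le> \<psi>y (x, t)"
      using u_ge_in_fluid[OF H surplus, of "(x, t)"] z fluid_subset by auto
    ultimately show "\<exists>y. ((\<lambda>t. P 0 0 (x, t) - \<gamma> / 4 * t\<^sup>2) has_real_derivative y) (at t) \<and> 0 \<le> y"
      by (intro exI[of _ "\<psi>y (x, t) - \<gamma> / 2 * t"]) simp
  next
    show "continuous_on {0..\<eta> x} (\<lambda>t. P 0 0 (x, t) - \<gamma> / 4 * t\<^sup>2)"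
      by (intro continuous_intros continuous_on_compose2[OF P_cont]) (auto simp: S_iff)
  qed
  thus ?thesis using psi_surface[of x] psi_bottom[of x] by (simp add: P0)
qed

text \<open>
  A vanishing surplus at the crest means \<open>u = \<gamma> \<eta> / 2\<close> there, so \<open>r = \<gamma>\<^sup>2 \<eta>\<^sup>2 / 8 + \<eta>\<close>; the depth bound
  then puts \<open>r\<close> below the critical value.
\<close>

lemma surplus_crest_nonzero:
  assumes "gamma_star < \<gamma>" and r: "lam_R \<gamma> (s_crit \<gamma>) \<le> r"
    and crest: "\<And>x. \<eta> x \<le> \<eta> 0" and surplus: "\<And>x. surplus 0 \<le> surplus x"
  shows "surplus 0 \<noteq> 0"
proof
  assume 0: "surplus 0 = 0"
  have d: "\<gamma> * (\<eta> 0)\<^sup>2 \<le> 4" by (rule depth_bound[OF crest]) (use surplus 0 in simp)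
  hence "(sqrt \<gamma> * \<eta> 0)\<^sup>2 \<le> 2\<^sup>2" using gamma_pos by (simp add: power_mult_distrib)
  hence "sqrt \<gamma> * \<eta> 0 \<le> 2" by (rule power2_le_imp_le) simp
  hence "\<eta> 0 \<le> 2 / sqrt \<gamma>" using gamma_pos by (simp add: field_simps)
  moreover have "\<psi>y (0, \<eta> 0) = \<gamma> / 2 * \<eta> 0" using 0 by (simp add: surplus_def)
  hence "(\<gamma> / 2 * \<eta> 0)\<^sup>2 = 2 * (r - \<eta> 0)" using crest_velocity[OF crest] by (simp only:)
  hence "\<gamma> / 8 * (\<gamma> * (\<eta> 0)\<^sup>2) + \<eta> 0 = r" by (simp add: power2_eq_square field_simps)
  moreover have "\<gamma> / 8 * (\<gamma> * (\<eta> 0)\<^sup>2) \<le> \<gamma> / 8 * 4" using d gamma_pos by (intro mult_left_mono) auto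
  ultimately show False using above_gamma_star(2)[OF assms(1)] r by simp
qed

text \<open>
  A bound for \<open>\<eta>' = v / u\<close> alone would need a lower bound for the depth. As \<open>u \<ge> \<gamma> \<eta> / 2\<close> and
  \<open>|v| \<le> \<surd>(2 r)\<close>, the product \<open>\<eta> \<eta>'\<close> is controlled by \<open>\<gamma>\<close> and \<open>r\<close> only.
\<close>

lemma eta_square_lipschitz:
  assumes surplus: "\<And>x. 0 \<le> surplus x"
  shows "\<bar>(\<eta> a)\<^sup>2 - (\<eta> b)\<^sup>2\<bar> \<le> 4 / \<gamma> * sqrt (2 * r) * \<bar>a - b\<bar>"
proof -
  have "\<bar>2 * \<eta> x * \<eta>' x\<bar> \<le> 4 / \<gamma> * sqrt (2 * r)" for x
  proof -
    have u: "0 < \<psi>y (x, \<eta> x)" by (rule u_pos[OF surface_in_S])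
    have "(\<psi>x (x, \<eta> x))\<^sup>2 \<le> 2 * r"
      using bernoulli[of x] eta_pos[of x] zero_le_power2[of "\<psi>y (x, \<eta> x)"] by argo
    hence "\<bar>\<psi>x (x, \<eta> x)\<bar> \<le> sqrt (2 * r)" by (rule real_le_rsqrt[of "\<bar>_\<bar>", simplified])
    hence "\<bar>\<eta>' x\<bar> * \<psi>y (x, \<eta> x) \<le> sqrt (2 * r)"
      using u unfolding kinematic by (simp add: abs_mult)
    moreover have "\<gamma> / 2 * \<eta> x \<le> \<psi>y (x, \<eta> x)" using surplus[of x] by (simp add: surplus_def)
    hence "\<bar>\<eta>' x\<bar> * (\<gamma> / 2 * \<eta> x) \<le> \<bar>\<eta>' x\<bar> * \<psi>y (x, \<eta> x)" by (intro mult_left_mono) auto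
    ultimately have "4 / \<gamma> * (\<bar>\<eta>' x\<bar> * (\<gamma> / 2 * \<eta> x)) \<le> 4 / \<gamma> * sqrt (2 * r)"
      using gamma_pos by (intro mult_left_mono) auto
    thus ?thesis using gamma_pos eta_pos[of x] by (simp add: abs_mult)
  qed
  thus ?thesis
    by (intro field_differentiable_bound[where S = UNIV and f = "\<lambda>x. (\<eta> x)\<^sup>2"
          and f' = "\<lambda>x. 2 * \<eta> x * \<eta>' x", unfolded real_norm_def])
       (auto intro!: derivative_eq_intros eta_deriv)
qed

section \<open>Laminar flows\<close>

text \<open>
  Here \<open>u\<^sub>y = \<gamma>\<close> throughout, so \<open>u - \<gamma> y / 2\<close> increases from its positive value at the bottom.
\<close>

lemma laminar_surplus_pos:
  assumes "laminar \<gamma> \<eta> \<psi> r"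
  shows "0 < surplus x"
proof -
  have x: "\<psi>x z = 0" if "z \<in> S" for z
  proof -
    have "snd (velocity S \<psi> z) = 0" using assms that unfolding laminar_def by blast
    thus ?thesis by (simp add: velocity[OF that])
  qed
  have xx: "\<psi>xx z = 0" if z: "z \<in> S" for z
  proof (rule closed_fluid_derivative_unique(1)[OF eta_pos eta_differentiable z P_deriv[OF z]])
    have 0: "((\<lambda>_. 0) has_derivative (\<lambda>(h, k). 0 * h + 0 * k)) (at z within S)"
      by (rule has_derivative_eq_rhs[OF has_derivative_const]) (simp add: fun_eq_iff)
    show "(\<psi>x has_derivative (\<lambda>(h, k). 0 * h + 0 * k)) (at z within S)"
      by (rule has_derivative_transform[OF z _ 0]) (rule x)
  qed
  have "\<psi>y (x, 0) - \<gamma> / 2 * 0 \<le> \<psi>y (x, \<eta> x) - \<gamma> / 2 * \<eta> x"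
  proof (rule DERIV_nonneg_imp_increasing_open[OF less_imp_le[OF eta_pos]])
    fix t assume "0 < t" "t < \<eta> x"
    hence z: "(x, t) \<in> fluid \<eta>" by (simp add: fluid_def)
    have "((\<lambda>t. \<psi>y (x, t) - \<gamma> / 2 * t) has_real_derivative \<psi>yy (x, t) - \<gamma> / 2) (at t)"
      by (auto intro!: derivative_eq_intros P_dy_fluid[OF z])
    moreover have "\<psi>yy (x, t) = \<gamma>"
      using poisson[OF z] xx[of "(x, t)"] z fluid_subset by auto
    ultimately show "\<exists>y. ((\<lambda>t. \<psi>y (x, t) - \<gamma> / 2 * t) has_real_derivative y) (at t) \<and> 0 \<le> y"
      using gamma_pos by (intro exI[of _ "\<psi>yy (x, t) - \<gamma> / 2"]) simp
  next
    show "continuous_on {0..\<eta> x} (\<lambda>t. \<psi>y (x, t) - \<gamma> / 2 * t)"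
      by (intro continuous_intros continuous_on_compose2[OF P_cont]) (auto simp: S_iff)
  qed
  thus ?thesis using u_pos[OF bottom_in_S, of x] by (simp add: surplus_def)
qed

section \<open>Stokes waves\<close>

lemma velocity_periodic:
  assumes L: "x_period \<eta> \<psi> L" and z: "(x, y) \<in> S"
  shows "\<psi>x (x + L, y) = \<psi>x (x, y)" and "\<psi>y (x + L, y) = \<psi>y (x, y)"
proof -
  let ?s = "\<lambda>w. w + (L, 0)"
  have \<eta>: "\<eta> (x + L) = \<eta> x" for x using L by (simp add: x_period_def)
  have s: "?s w \<in> S" "\<psi> (?s w) = \<psi> w" if "w \<in> S" for w
    using L that \<eta>[of "fst w"] by (cases w; force simp: x_period_def S_iff)+
  have "(\<psi> has_derivative (\<lambda>(h, k). \<psi>x (?s (x, y)) * h + \<psi>y (?s (x, y)) * k)) (at (?s (x, y)) within S)"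
    using P_deriv[OF s(1)[OF z], of 0 0] unfolding P0 .
  hence 1: "(\<psi> has_derivative (\<lambda>(h, k). \<psi>x (?s (x, y)) * h + \<psi>y (?s (x, y)) * k)) (at (?s (x, y)) within ?s ` S)"
    by (rule has_derivative_subset) (use s(1) in auto)
  have 2: "(?s has_derivative (\<lambda>h. h)) (at (x, y) within S)"
    by (auto intro!: derivative_eq_intros)
  have "(\<psi> has_derivative (\<lambda>(h, k). \<psi>x (?s (x, y)) * h + \<psi>y (?s (x, y)) * k)) (at (x, y) within S)"
    by (rule has_derivative_transform[OF z _ has_derivative_in_compose[OF 2 1]]) (simp only: s(2))
  from closed_fluid_derivative_unique[OF eta_pos eta_differentiable z this P_deriv[OF z, of 0 0, unfolded P0]]
  show "\<psi>x (x + L, y) = \<psi>x (x, y)" and "\<psi>y (x + L, y) = \<psi>y (x, y)" by simp_all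
qed

lemma speed_bounded_in_box: "\<exists>B. \<forall>z\<in>S. \<bar>fst z\<bar> \<le> X \<longrightarrow> (\<psi>x z)\<^sup>2 + (\<psi>y z)\<^sup>2 \<le> B"
proof -
  have "compact ((\<lambda>z. (\<psi>x z)\<^sup>2 + (\<psi>y z)\<^sup>2) ` (S \<inter> {z. \<bar>fst z\<bar> \<le> X}))"
    by (intro compact_continuous_image compact_fluid_box eta_cont continuous_intros
        continuous_on_subset[OF P_cont]) auto
  hence "bdd_above ((\<lambda>z. (\<psi>x z)\<^sup>2 + (\<psi>y z)\<^sup>2) ` (S \<inter> {z. \<bar>fst z\<bar> \<le> X}))"
    by (intro bounded_imp_bdd_above compact_imp_bounded)
  thus ?thesis by (auto simp: bdd_above_def)
qed

lemma speed_bounded_stokes: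
  assumes L: "x_period \<eta> \<psi> L"
  shows "\<exists>B. \<forall>z\<in>S. (\<psi>x z)\<^sup>2 + (\<psi>y z)\<^sup>2 \<le> B"
proof -
  have "0 < L" and \<eta>: "\<And>x. \<eta> (x + L) = \<eta> x" using L by (auto simp: x_period_def)
  obtain B where B: "\<And>z. z \<in> S \<Longrightarrow> \<bar>fst z\<bar> \<le> L \<Longrightarrow> (\<psi>x z)\<^sup>2 + (\<psi>y z)\<^sup>2 \<le> B"
    using speed_bounded_in_box[of L] by blast
  (* all data above x, so that one shift serves every height at once *)
  define column where "column = (\<lambda>x. (\<eta> x, \<lambda>y. if (x, y) \<in> S then (\<psi>x (x, y))\<^sup>2 + (\<psi>y (x, y))\<^sup>2 else 0))"
  have per: "column (x + L) = column x" for x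
    using velocity_periodic[OF L] \<eta>[of x] by (auto simp: column_def fun_eq_iff S_iff)
  have "(\<psi>x z)\<^sup>2 + (\<psi>y z)\<^sup>2 \<le> B" if z: "z \<in> S" for z
  proof -
    obtain x y where xy: "z = (x, y)" by (cases z)
    obtain x' where x': "x' \<in> {0..L}" "column x' = column x"
      using periodic_value_in_Icc[where f = column, OF \<open>0 < L\<close> per] by blast
    have "\<eta> x' = \<eta> x" using x'(2) by (simp add: column_def)
    hence z': "(x', y) \<in> S" using z by (simp add: xy S_iff)
    have "snd (column x') y = snd (column x) y" using x'(2) by simp
    hence "(\<psi>x (x', y))\<^sup>2 + (\<psi>y (x', y))\<^sup>2 = (\<psi>x z)\<^sup>2 + (\<psi>y z)\<^sup>2"
      using z z' by (simp add: column_def xy)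
    thus ?thesis using B[OF z'] x'(1) by simp
  qed
  thus ?thesis by blast
qed

text \<open>
  Let \<open>\<Psi>\<close> be the laminar stream function whose depth \<open>d\<close> is that of the trough. Then \<open>\<psi> - \<Psi>\<close> is
  harmonic, zero at the bottom, and nonpositive on the surface, since \<open>\<Psi>\<close> exceeds \<open>1\<close> above depth \<open>d\<close>.
  It vanishes at the trough, hence \<open>\<psi>\<^sub>y \<ge> \<Psi>\<^sub>y > 0\<close> there, and Bernoulli's law shows that \<open>r\<close> is at
  least the Bernoulli constant of \<open>\<Psi>\<close>.
\<close>

lemma bernoulli_constant_stokes:
  assumes L: "x_period \<eta> \<psi> L"
  shows "lam_R \<gamma> (s_crit \<gamma>) \<le> r"
proof -
  have "0 < L" and per: "\<And>x. \<eta> (x + L) = \<eta> x" using L by (auto simp: x_period_def)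
  obtain m where "\<forall>x\<in>{0..L}. \<eta> m \<le> \<eta> x"
    using continuous_attains_inf[OF compact_Icc _ eta_cont, of 0 L] \<open>0 < L\<close>
    by (metis atLeastAtMost_iff empty_iff order_refl less_imp_le)
  hence trough: "\<eta> m \<le> \<eta> x" for x
    using periodic_value_in_Icc[of L \<eta> x] \<open>0 < L\<close> per by metis
  obtain H where "\<forall>x\<in>{0..L}. \<eta> x \<le> H"
    using continuous_attains_sup[OF compact_Icc _ eta_cont, of 0 L] \<open>0 < L\<close>
    by (metis atLeastAtMost_iff empty_iff order_refl less_imp_le)
  hence H: "\<eta> x \<le> H" for x
    using periodic_value_in_Icc[of L \<eta> x] \<open>0 < L\<close> per by metis
  define d where "d = \<eta> m"
  have "0 < d" using eta_pos by (simp add: d_def)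
  (* the laminar flow of depth d: s solves \<gamma> d^2 / 2 + s d = 1 *)
  define s where "s = 1 / d - \<gamma> * d / 2"
  have sd: "\<gamma> / 2 * d\<^sup>2 + s * d = 1" and ud: "\<gamma> * d + s = 1 / d + \<gamma> * d / 2"
    using \<open>0 < d\<close> by (simp_all add: s_def field_simps power2_eq_square)
  have "0 < \<gamma> * d + s" unfolding ud using \<open>0 < d\<close> gamma_pos by (intro add_pos_pos) auto
  have le: "P 0 0 z - (\<gamma> / 2 * (snd z)\<^sup>2 + s * snd z) \<le> 0" if z: "z \<in> S" for z
  proof (rule fluid_max_principle[OF eta_cont eta_pos H _ _ _ _ _ _ _ _ _ z])
    show "continuous_on S (\<lambda>z. P 0 0 z - (\<gamma> / 2 * (snd z)\<^sup>2 + s * snd z))"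
      by (intro continuous_intros P_cont)
    show "P 0 0 w - (\<gamma> / 2 * (snd w)\<^sup>2 + s * snd w) \<le> 1 + \<bar>s\<bar> * H" if "w \<in> S" for w
    proof -
      have w: "0 \<le> snd w" "snd w \<le> H" using that H[of "fst w"] by (cases w; auto simp: S_iff)+
      have "- s * snd w \<le> \<bar>s\<bar> * H" using w by (intro mult_mono) auto
      moreover have "0 \<le> \<gamma> / 2 * (snd w)\<^sup>2" using gamma_pos by simp
      ultimately show ?thesis using psi_le_1[OF that] unfolding P0 by linarith
    qed
    show "((\<lambda>t. P 0 0 (t, y) - (\<gamma> / 2 * (snd (t, y))\<^sup>2 + s * snd (t, y))) has_real_derivative \<psi>x (x, y)) (at x)"
      if "(x, y) \<in> fluid \<eta>" for x y
      by (auto intro!: derivative_eq_intros P_dx_fluid[OF that])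
    show "((\<lambda>t. \<psi>x (t, y)) has_real_derivative \<psi>xx (x, y)) (at x)" if "(x, y) \<in> fluid \<eta>" for x y
      by (rule P_dx_fluid[OF that])
    show "((\<lambda>t. P 0 0 (x, t) - (\<gamma> / 2 * (snd (x, t))\<^sup>2 + s * snd (x, t))) has_real_derivative
        \<psi>y (x, y) - (\<gamma> * snd (x, y) + s)) (at y)" if "(x, y) \<in> fluid \<eta>" for x y
      by (auto intro!: derivative_eq_intros P_dy_fluid[OF that])
    show "((\<lambda>t. \<psi>y (x, t) - (\<gamma> * snd (x, t) + s)) has_real_derivative \<psi>yy (x, y) - \<gamma>) (at y)"
      if "(x, y) \<in> fluid \<eta>" for x y
      by (auto intro!: derivative_eq_intros P_dy_fluid[OF that])
    show "0 \<le> \<psi>xx w + (\<psi>yy w - \<gamma>)" if "w \<in> fluid \<eta>" for w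
      using poisson[OF that] by simp
    show "P 0 0 (x, \<eta> x) - (\<gamma> / 2 * (snd (x, \<eta> x))\<^sup>2 + s * snd (x, \<eta> x)) \<le> 0" for x
    proof -
      have "0 \<le> \<gamma> / 2 * (\<eta> x - d)\<^sup>2 + (\<gamma> * d + s) * (\<eta> x - d)"
        using mult_nonneg_nonneg[of "\<gamma> * d + s" "\<eta> x - d"] \<open>0 < \<gamma> * d + s\<close> trough[of x] gamma_pos
        by (intro add_nonneg_nonneg) (simp_all add: d_def)
      also have "\<dots> = \<gamma> / 2 * (\<eta> x)\<^sup>2 + s * \<eta> x - (\<gamma> / 2 * d\<^sup>2 + s * d)"
        by (simp add: field_simps power2_eq_square)
      finally show ?thesis unfolding sd by (simp add: P0 psi_surface)
    qed
    show "P 0 0 (x, 0) - (\<gamma> / 2 * (snd (x, 0))\<^sup>2 + s * snd (x, 0)) \<le> 0 \<or>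
        (\<exists>b>0. ((\<lambda>t. P 0 0 (x, t) - (\<gamma> / 2 * (snd (x, t))\<^sup>2 + s * snd (x, t))) has_real_derivative b)
          (at 0 within {0..\<eta> x}))" for x
      by (simp add: P0 psi_bottom)
  qed
  have "0 \<le> \<psi>y (m, d) - (\<gamma> * d + s)"
  proof (rule derivative_nonneg_at_right_max[OF \<open>0 < d\<close>])
    have m: "(m, d) \<in> S" unfolding d_def by (rule surface_in_S)
    show "((\<lambda>t. P 0 0 (m, t) - (\<gamma> / 2 * t\<^sup>2 + s * t)) has_real_derivative
        \<psi>y (m, d) - (\<gamma> * d + s)) (at d within {0..d})"
      by (auto intro!: derivative_eq_intros P_dy[OF m, folded d_def])
    show "P 0 0 (m, t) - (\<gamma> / 2 * t\<^sup>2 + s * t) \<le> P 0 0 (m, d) - (\<gamma> / 2 * d\<^sup>2 + s * d)"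
      if "t \<in> {0..d}" for t
      using le[of "(m, t)"] that psi_surface[of m] unfolding sd by (simp add: S_iff d_def P0)
  qed
  hence "(\<gamma> * d + s)\<^sup>2 \<le> (\<psi>y (m, d))\<^sup>2" using \<open>0 < \<gamma> * d + s\<close> by (intro power_mono) auto
  hence "(\<gamma> * d + s)\<^sup>2 / 2 + d \<le> r"
    using bernoulli[of m] zero_le_power2[of "\<psi>x (m, d)"] unfolding d_def by argo
  moreover have "(\<gamma> * d + s)\<^sup>2 = s\<^sup>2 + 2 * \<gamma> * (\<gamma> / 2 * d\<^sup>2 + s * d)"
    by (simp add: power2_eq_square algebra_simps)
  hence sq: "(\<gamma> * d + s)\<^sup>2 = s\<^sup>2 + 2 * \<gamma>" unfolding sd by simp
  moreover have "lam_depth \<gamma> s = d"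
    unfolding lam_depth_def sq[symmetric] using \<open>0 < \<gamma> * d + s\<close> gamma_pos by simp
  ultimately have "lam_R \<gamma> s \<le> r" by (simp add: lam_R_def add_divide_distrib)
  thus ?thesis using lam_R_min[OF gamma_pos, of s] by linarith
qed

section \<open>Solitary waves\<close>

lemma solitary_limits:
  assumes "solitary_wave \<gamma> \<eta> \<psi> r"
  obtains s where "(\<eta> \<longlongrightarrow> lam_depth \<gamma> s) at_infinity"
    and "((\<lambda>x. \<psi>y (x, \<eta> x)) \<longlongrightarrow> \<gamma> * lam_depth \<gamma> s + s) at_infinity"
    and "r = lam_R \<gamma> s" and "(\<gamma> * lam_depth \<gamma> s + s)\<^sup>2 / 2 + lam_depth \<gamma> s = r"
    and "\<forall>\<^sub>F x in at_infinity. \<forall>y\<in>{0..\<eta> x}. \<bar>\<psi>y (x, y) - (\<gamma> * y + s)\<bar> < 1 \<and> \<bar>\<psi>x (x, y)\<bar> < 1"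
proof -
  obtain s where d: "(\<eta> \<longlongrightarrow> lam_depth \<gamma> s) at_infinity"
    and v: "\<And>\<epsilon>. 0 < \<epsilon> \<Longrightarrow> \<forall>\<^sub>F x in at_infinity. \<forall>y\<in>{0..\<eta> x}.
             dist (velocity S \<psi> (x, y)) (\<gamma> * y + s, 0) < \<epsilon>"
    using assms unfolding solitary_wave_def by blast
  let ?d = "lam_depth \<gamma> s"
  have close: "\<forall>\<^sub>F x in at_infinity. \<forall>y\<in>{0..\<eta> x}. \<bar>\<psi>y (x, y) - (\<gamma> * y + s)\<bar> < \<epsilon> \<and> \<bar>\<psi>x (x, y)\<bar> < \<epsilon>"
    if "0 < \<epsilon>" for \<epsilon>
    using v[OF that]
  proof eventually_elim
    case (elim x)
    show ?case
    proof
      fix y assume y: "y \<in> {0..\<eta> x}"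
      have *: "dist (\<psi>y (x, y), - \<psi>x (x, y)) (\<gamma> * y + s, 0) < \<epsilon>"
        using bspec[OF elim y] y velocity[of "(x, y)"] by (simp only: S_iff atLeastAtMost_iff)
      show "\<bar>\<psi>y (x, y) - (\<gamma> * y + s)\<bar> < \<epsilon> \<and> \<bar>\<psi>x (x, y)\<bar> < \<epsilon>"
        using le_less_trans[OF dist_fst_le *] le_less_trans[OF dist_snd_le *] by (simp add: dist_real_def)
    qed
  qed
  have surf: "\<eta> x \<in> {0..\<eta> x}" for x using eta_pos[of x] by simp
  have "((\<lambda>x. \<psi>y (x, \<eta> x) - (\<gamma> * \<eta> x + s)) \<longlongrightarrow> 0) at_infinity"
  proof (rule tendstoI)
    fix \<epsilon> :: real assume "0 < \<epsilon>"
    from close[OF this] show "\<forall>\<^sub>F x in at_infinity. dist (\<psi>y (x, \<eta> x) - (\<gamma> * \<eta> x + s)) 0 < \<epsilon>"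
      by eventually_elim (use surf in auto)
  qed
  from tendsto_add[OF this tendsto_add[OF tendsto_mult_left[OF d, of \<gamma>] tendsto_const[of s]]]
  have U: "((\<lambda>x. \<psi>y (x, \<eta> x)) \<longlongrightarrow> \<gamma> * ?d + s) at_infinity" by simp
  have V: "((\<lambda>x. \<psi>x (x, \<eta> x)) \<longlongrightarrow> 0) at_infinity"
  proof (rule tendstoI)
    fix \<epsilon> :: real assume "0 < \<epsilon>"
    from close[OF this] show "\<forall>\<^sub>F x in at_infinity. dist (\<psi>x (x, \<eta> x)) 0 < \<epsilon>"
      by eventually_elim (use surf in auto)
  qed
  have "((\<lambda>x. ((\<psi>x (x, \<eta> x))\<^sup>2 + (\<psi>y (x, \<eta> x))\<^sup>2) / 2 + \<eta> x) \<longlongrightarrow> (0\<^sup>2 + (\<gamma> * ?d + s)\<^sup>2) / 2 + ?d) at_infinity"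
    by (intro tendsto_intros U V d) auto
  hence "((\<lambda>x::real. r) \<longlongrightarrow> (\<gamma> * ?d + s)\<^sup>2 / 2 + ?d) at_infinity" unfolding bernoulli by simp
  hence r: "(\<gamma> * ?d + s)\<^sup>2 / 2 + ?d = r"
    using tendsto_unique[OF trivial_limit_at_infinity _ tendsto_const] by metis
  have "\<gamma> * ?d + s = sqrt (s\<^sup>2 + 2 * \<gamma>)" using gamma_pos by (simp add: lam_depth_def)
  hence "(\<gamma> * ?d + s)\<^sup>2 = s\<^sup>2 + 2 * \<gamma>" using gamma_pos by simp
  hence "r = lam_R \<gamma> s" using r by (simp add: lam_R_def add_divide_distrib)
  from that[OF d U this r close[of 1]] show thesis by simp
qed

lemma speed_bounded_solitary:
  assumes "solitary_wave \<gamma> \<eta> \<psi> r" and H: "\<And>x. \<eta> x \<le> H"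
  shows "\<exists>B. \<forall>z\<in>S. (\<psi>x z)\<^sup>2 + (\<psi>y z)\<^sup>2 \<le> B"
proof -
  obtain s where "\<forall>\<^sub>F x in at_infinity. \<forall>y\<in>{0..\<eta> x}. \<bar>\<psi>y (x, y) - (\<gamma> * y + s)\<bar> < 1 \<and> \<bar>\<psi>x (x, y)\<bar> < 1"
    using solitary_limits[OF assms(1)] by blast
  then obtain X where X: "\<And>x y. X \<le> \<bar>x\<bar> \<Longrightarrow> y \<in> {0..\<eta> x} \<Longrightarrow> \<bar>\<psi>y (x, y) - (\<gamma> * y + s)\<bar> < 1 \<and> \<bar>\<psi>x (x, y)\<bar> < 1"
    unfolding eventually_at_infinity real_norm_def by blast
  obtain B where B: "\<And>z. z \<in> S \<Longrightarrow> \<bar>fst z\<bar> \<le> X \<Longrightarrow> (\<psi>x z)\<^sup>2 + (\<psi>y z)\<^sup>2 \<le> B"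
    using speed_bounded_in_box[of X] by blast
  let ?C = "1\<^sup>2 + (\<gamma> * H + \<bar>s\<bar> + 1)\<^sup>2"
  have "(\<psi>x (x, y))\<^sup>2 + (\<psi>y (x, y))\<^sup>2 \<le> max B ?C" if z: "(x, y) \<in> S" for x y
  proof (cases "\<bar>x\<bar> \<le> X")
    case True
    thus ?thesis using B[OF z] by simp
  next
    case False
    have y: "0 \<le> y" "y \<le> \<eta> x" "y \<le> H" using z H[of x] by (auto simp: S_iff)
    have "\<gamma> * y \<le> \<gamma> * H" "0 \<le> \<gamma> * y" using y gamma_pos by (auto intro: mult_left_mono)
    moreover have "\<bar>\<psi>y (x, y) - (\<gamma> * y + s)\<bar> < 1" "\<bar>\<psi>x (x, y)\<bar> \<le> 1"
      using X[of x y] False y by auto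
    ultimately have "\<bar>\<psi>y (x, y)\<bar> \<le> \<gamma> * H + \<bar>s\<bar> + 1" "\<bar>\<psi>x (x, y)\<bar> \<le> 1" by linarith+
    hence "(\<psi>x (x, y))\<^sup>2 + (\<psi>y (x, y))\<^sup>2 \<le> ?C"
      by (intro add_mono power2_le_iff_abs_le[THEN iffD2]) auto
    thus ?thesis by simp
  qed
  thus ?thesis by (intro exI[of _ "max B ?C"]) auto
qed

text \<open>
  The type of wave enters only through three properties: the lower bound for \<open>r\<close>, boundedness of the
  velocity, and the behaviour of the surface data at the ends.
\<close>

lemma surplus_least_and_nonzero_at_crest:
  assumes wave: "stokes_wave \<gamma> \<eta> \<psi> r \<or> solitary_wave \<gamma> \<eta> \<psi> r"
    and crest: "\<And>x. \<eta> x \<le> \<eta> 0"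
  shows "surplus 0 \<le> surplus x" and "gamma_star < \<gamma> \<Longrightarrow> surplus 0 \<noteq> 0"
proof -
  have *: "lam_R \<gamma> (s_crit \<gamma>) \<le> r \<and> (\<exists>B. \<forall>z\<in>S. (\<psi>x z)\<^sup>2 + (\<psi>y z)\<^sup>2 \<le> B) \<and>
    ((\<exists>L>0. \<forall>x. \<eta> (x + L) = \<eta> x \<and> \<psi>y (x + L, \<eta> (x + L)) = \<psi>y (x, \<eta> x)) \<or>
     (\<exists>d U. (\<eta> \<longlongrightarrow> d) at_infinity \<and> ((\<lambda>x. \<psi>y (x, \<eta> x)) \<longlongrightarrow> U) at_infinity \<and> U\<^sup>2 / 2 + d = r))"
    using wave
  proof
    assume "stokes_wave \<gamma> \<eta> \<psi> r"
    then obtain L where L: "x_period \<eta> \<psi> L" unfolding stokes_wave_def by blast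
    hence "0 < L" and \<eta>: "\<And>x. \<eta> (x + L) = \<eta> x" by (auto simp: x_period_def)
    have "\<psi>y (x + L, \<eta> (x + L)) = \<psi>y (x, \<eta> x)" for x
      unfolding \<eta> by (rule velocity_periodic(2)[OF L surface_in_S])
    with \<open>0 < L\<close> \<eta> show ?thesis
      using bernoulli_constant_stokes[OF L] speed_bounded_stokes[OF L] by blast
  next
    assume sol: "solitary_wave \<gamma> \<eta> \<psi> r"
    obtain s where s: "(\<eta> \<longlongrightarrow> lam_depth \<gamma> s) at_infinity"
      "((\<lambda>x. \<psi>y (x, \<eta> x)) \<longlongrightarrow> \<gamma> * lam_depth \<gamma> s + s) at_infinity"
      "r = lam_R \<gamma> s" "(\<gamma> * lam_depth \<gamma> s + s)\<^sup>2 / 2 + lam_depth \<gamma> s = r"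
      using solitary_limits[OF sol] by blast
    have "lam_R \<gamma> (s_crit \<gamma>) \<le> r" unfolding s(3) by (rule lam_R_min[OF gamma_pos])
    with s(1,2,4) show ?thesis using speed_bounded_solitary[OF sol crest] by blast
  qed
  then obtain B where B: "\<And>z. z \<in> S \<Longrightarrow> (\<psi>x z)\<^sup>2 + (\<psi>y z)\<^sup>2 \<le> B" by blast
  show surplus: "surplus 0 \<le> surplus x" for x
    by (rule surplus_ge_crest[OF crest B]) (use * in blast)+
  show "surplus 0 \<noteq> 0" if "gamma_star < \<gamma>"
    by (rule surplus_crest_nonzero[OF that _ crest surplus]) (use * in blast)
qed

end

section \<open>The family of waves\<close>

lemma unidirectional_flow_exists:
  assumes "0 < \<gamma>" "wave_solution \<gamma> \<eta> \<psi> r" "unidirectional \<eta> \<psi>"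
  obtains P where "unidirectional_flow \<gamma> \<eta> \<psi> r P"
proof -
  have "smooth_on (closed_fluid \<eta>) \<psi>" using assms(2) unfolding wave_solution_def by blast
  then obtain P where "P 0 0 = \<psi>" and "\<And>i j z. z \<in> closed_fluid \<eta> \<Longrightarrow>
      (P i j has_derivative (\<lambda>(h, k). P (Suc i) j z * h + P i (Suc j) z * k))
        (at z within closed_fluid \<eta>)"
    unfolding smooth_on_def by blast
  with assms have "unidirectional_flow \<gamma> \<eta> \<psi> r P" by unfold_locales
  thus thesis by (rule that)
qed

text \<open>
  The surplus at the crest is a continuous function of \<open>t\<close>, positive at the laminar end and never zero,
  so it is positive throughout.
\<close>

lemma family_surplus_nonneg:
  assumes \<gamma>: "gamma_star < \<gamma>"
    and W: "W = stokes_wave \<or> W = solitary_wave"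
    and fam: "unidirectional_family W \<gamma> T \<eta> \<psi> r"
    and t: "t \<in> {0..<T}"
  shows "\<exists>P. unidirectional_flow \<gamma> (\<eta> t) (\<psi> t) (r t) P \<and>
    (\<forall>x. \<eta> t x \<le> \<eta> t 0) \<and> (\<forall>x. 0 \<le> unidirectional_flow.surplus \<gamma> (\<eta> t) P x)"
proof -
  have lam: "laminar \<gamma> (\<eta> 0) (\<psi> 0) (r 0)"
    and wave: "\<And>t. t \<in> {0<..<T} \<Longrightarrow> W \<gamma> (\<eta> t) (\<psi> t) (r t)"
    and "\<And>t x. t \<in> {0<..<T} \<Longrightarrow> \<eta> t x \<le> \<eta> t 0"
    and uni: "\<And>t. t \<in> {0..<T} \<Longrightarrow> unidirectional (\<eta> t) (\<psi> t)"
    and cont: "continuous_on {0..<T} (\<lambda>t. eta_hat (\<eta> t))"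
      "continuous_on {0..<T} (\<lambda>t. u_hat (\<eta> t) (\<psi> t))"
    using fam unfolding unidirectional_family_def by blast+
  moreover have "\<eta> 0 x \<le> \<eta> 0 0" for x using lam unfolding laminar_def by (metis order_refl)
  ultimately have crest: "\<eta> t x \<le> \<eta> t 0" if "t \<in> {0..<T}" for t x
    using that by (cases "t = 0") auto
  have sol: "wave_solution \<gamma> (\<eta> t) (\<psi> t) (r t)" if "t \<in> {0..<T}" for t
    using lam wave[of t] that W
    by (cases "t = 0") (auto simp: laminar_def stokes_wave_def solitary_wave_def)
  have "0 < \<gamma>" using \<gamma> by (rule above_gamma_star)
  define \<Phi> where "\<Phi> = (\<lambda>t. u_hat (\<eta> t) (\<psi> t) - \<gamma> / 2 * eta_hat (\<eta> t))"
  have \<Phi>: "\<Phi> t = unidirectional_flow.surplus \<gamma> (\<eta> t) P 0"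
    if "t \<in> {0..<T}" and P: "unidirectional_flow \<gamma> (\<eta> t) (\<psi> t) (r t) P" for t P
  proof -
    interpret unidirectional_flow \<gamma> "\<eta> t" "\<psi> t" "r t" P by (rule P)
    have "eta_hat (\<eta> t) = \<eta> t 0"
      unfolding eta_hat_def using crest[OF that(1)] by (intro cSup_eq_maximum) auto
    thus ?thesis by (simp add: \<Phi>_def u_hat_def surplus_def velocity[OF surface_in_S])
  qed
  have flow: "\<exists>P. unidirectional_flow \<gamma> (\<eta> t) (\<psi> t) (r t) P" if "t \<in> {0..<T}" for t
    using unidirectional_flow_exists[OF \<open>0 < \<gamma>\<close> sol[OF that] uni[OF that]] by blast
  have pos0: "0 < unidirectional_flow.surplus \<gamma> (\<eta> 0) P x"
    if "unidirectional_flow \<gamma> (\<eta> 0) (\<psi> 0) (r 0) P" for P x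
    by (rule unidirectional_flow.laminar_surplus_pos[OF that lam])
  have nonzero: "\<Phi> t \<noteq> 0" if "t \<in> {0<..<T}" for t
  proof -
    from that have t: "t \<in> {0..<T}" by auto
    then obtain P where P: "unidirectional_flow \<gamma> (\<eta> t) (\<psi> t) (r t) P" using flow by blast
    show ?thesis unfolding \<Phi>[OF t P]
      by (rule unidirectional_flow.surplus_least_and_nonzero_at_crest(2)[OF P _ crest[OF t] \<gamma>]) (use W wave[OF that] in auto)
  qed
  have pos: "0 < \<Phi> t" if t: "t \<in> {0..<T}" for t
  proof (rule ccontr)
    assume "\<not> 0 < \<Phi> t"
    have "0 \<in> {0..<T}" using t by auto
    then obtain P where P: "unidirectional_flow \<gamma> (\<eta> 0) (\<psi> 0) (r 0) P" using flow by blast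
    have "0 < \<Phi> 0" using pos0[OF P] \<Phi>[OF \<open>0 \<in> {0..<T}\<close> P] by simp
    moreover have "continuous_on {0..t} \<Phi>"
      unfolding \<Phi>_def using t by (intro continuous_intros continuous_on_subset[OF cont(1)] continuous_on_subset[OF cont(2)]) auto
    ultimately obtain s where "0 \<le> s" "s \<le> t" "\<Phi> s = 0"
      using IVT2'[of \<Phi> t 0 0] \<open>\<not> 0 < \<Phi> t\<close> t by auto
    moreover have "s \<noteq> 0" using \<open>0 < \<Phi> 0\<close> \<open>\<Phi> s = 0\<close> by auto
    ultimately show False using nonzero[of s] t by auto
  qed
  obtain P where P: "unidirectional_flow \<gamma> (\<eta> t) (\<psi> t) (r t) P" using flow t by blast
  have "0 \<le> unidirectional_flow.surplus \<gamma> (\<eta> t) P x" for x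
  proof (cases "t = 0")
    case True
    thus ?thesis using pos0 P by (simp add: less_imp_le)
  next
    case False
    hence "t \<in> {0<..<T}" using t by auto
    hence "unidirectional_flow.surplus \<gamma> (\<eta> t) P 0 \<le> unidirectional_flow.surplus \<gamma> (\<eta> t) P x"
      by (intro unidirectional_flow.surplus_least_and_nonzero_at_crest(1)[OF P _ crest[OF t]]) (use W wave in auto)
    thus ?thesis using pos[OF t] \<Phi>[OF t P] by simp
  qed
  with P crest[OF t] show ?thesis by blast
qed

text \<open>
  These are the facts that pass to limits of the family, stated without reference to a chosen array of
  partial derivatives.
\<close>

lemma family_estimates:
  assumes "gamma_star < \<gamma>" "W = stokes_wave \<or> W = solitary_wave"
    and "unidirectional_family W \<gamma> T \<eta> \<psi> r" and "t \<in> {0..<T}"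
  shows "z \<in> closed_fluid (\<eta> t) \<Longrightarrow> \<gamma> / 2 * snd z \<le> fst (velocity (closed_fluid (\<eta> t)) (\<psi> t) z)"
    and "(x, \<eta> t x) \<in> closed_fluid (\<eta> t)"
    and "((fst (velocity (closed_fluid (\<eta> t)) (\<psi> t) (x, \<eta> t x)))\<^sup>2
        + (snd (velocity (closed_fluid (\<eta> t)) (\<psi> t) (x, \<eta> t x)))\<^sup>2) / 2 + \<eta> t x = r t"
    and "\<bar>(\<eta> t a)\<^sup>2 - (\<eta> t b)\<^sup>2\<bar> \<le> 4 / \<gamma> * sqrt (2 * r t) * \<bar>a - b\<bar>"
proof -
  obtain P where "unidirectional_flow \<gamma> (\<eta> t) (\<psi> t) (r t) P"
    and crest: "\<And>x. \<eta> t x \<le> \<eta> t 0" and surplus: "\<And>x. 0 \<le> unidirectional_flow.surplus \<gamma> (\<eta> t) P x"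
    using family_surplus_nonneg[OF assms] by blast
  then interpret unidirectional_flow \<gamma> "\<eta> t" "\<psi> t" "r t" P by simp
  show "\<gamma> / 2 * snd z \<le> fst (velocity S (\<psi> t) z)" if "z \<in> S"
    using u_ge_in_fluid[OF crest surplus that] velocity[OF that] by simp
  show "(x, \<eta> t x) \<in> S" by (rule surface_in_S)
  show "((fst (velocity S (\<psi> t) (x, \<eta> t x)))\<^sup>2 + (snd (velocity S (\<psi> t) (x, \<eta> t x)))\<^sup>2) / 2 + \<eta> t x = r t"
    using bernoulli[of x] by (simp add: velocity[OF surface_in_S] add.commute)
  show "\<bar>(\<eta> t a)\<^sup>2 - (\<eta> t b)\<^sup>2\<bar> \<le> 4 / \<gamma> * sqrt (2 * r t) * \<bar>a - b\<bar>"
    by (rule eta_square_lipschitz[OF surplus])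
qed

section \<open>Limits of the family\<close>

text \<open>
  An implicit function theorem at a boundary point: \<open>f\<close> is differentiable only within \<open>S\<close>, but the
  graph is already known to be continuous.
\<close>

lemma level_curve_has_derivative:
  fixes f :: "real \<times> real \<Rightarrow> real"
  assumes f: "(f has_derivative (\<lambda>(p, q). A * p + B * q)) (at (x0, h x0) within S)"
    and "0 < B" and h: "isCont h x0"
    and S: "\<And>x. (x, h x) \<in> S" and level: "\<And>x. f (x, h x) = c"
  shows "(h has_real_derivative - A / B) (at x0)"
proof -
  define M where "M = 1 + 2 / B * (\<bar>A\<bar> + B / 2)"
  have "0 < M" using \<open>0 < B\<close> by (auto simp: M_def intro!: add_pos_nonneg mult_nonneg_nonneg)
  have main: "\<exists>d>0. \<forall>y. norm (y - x0) < d \<longrightarrow> norm (h y - h x0 - (- A / B) * (y - x0)) \<le> e * norm (y - x0)"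
    if "0 < e" for e
  proof -
    (* B / 2 yields |h y - h x0| <= (M - 1) |y - x0|, then e * B / M the required accuracy *)
    define e' where "e' = min (B / 2) (e * B / M)"
    have "0 < e'" "e' \<le> B / 2" "e' * M \<le> e * B"
      using \<open>0 < B\<close> \<open>0 < e\<close> \<open>0 < M\<close> by (auto simp: e'_def min_def field_simps)
    from f[unfolded has_derivative_within_alt] \<open>0 < e'\<close>
    obtain d where "0 < d" and d: "\<And>z. z \<in> S \<Longrightarrow> norm (z - (x0, h x0)) < d \<Longrightarrow>
        norm (f z - f (x0, h x0) - (\<lambda>(p, q). A * p + B * q) (z - (x0, h x0))) \<le> e' * norm (z - (x0, h x0))"
      by blast
    have "isCont (\<lambda>x. (x, h x)) x0" using h by (intro continuous_intros)
    then obtain d' where "0 < d'" and d': "\<And>y. dist y x0 < d' \<Longrightarrow> dist (y, h y) (x0, h x0) < d"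
      using \<open>0 < d\<close> unfolding continuous_at_eps_delta by blast
    have "norm (h y - h x0 - (- A / B) * (y - x0)) \<le> e * norm (y - x0)" if "norm (y - x0) < d'" for y
    proof -
      define p q where "p = y - x0" and "q = h y - h x0"
      have "norm ((y, h y) - (x0, h x0)) < d" using d'[of y] that by (simp add: dist_norm)
      from d[OF S this] have "\<bar>A * p + B * q\<bar> \<le> e' * norm (p, q)"
        by (simp add: level p_def q_def)
      also have "\<dots> \<le> e' * (\<bar>p\<bar> + \<bar>q\<bar>)"
        using norm_Pair_le[of p q] \<open>0 < e'\<close> by (intro mult_left_mono) auto
      finally have *: "\<bar>A * p + B * q\<bar> \<le> e' * (\<bar>p\<bar> + \<bar>q\<bar>)" .
      also have "\<dots> \<le> B / 2 * (\<bar>p\<bar> + \<bar>q\<bar>)" using \<open>e' \<le> B / 2\<close> by (intro mult_right_mono) auto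
      finally have "\<bar>A * p + B * q\<bar> \<le> B / 2 * \<bar>p\<bar> + B / 2 * \<bar>q\<bar>" by (simp add: algebra_simps)
      moreover have "B * \<bar>q\<bar> \<le> \<bar>A * p + B * q\<bar> + \<bar>A\<bar> * \<bar>p\<bar>"
        using abs_triangle_ineq[of "A * p + B * q" "- (A * p)"] \<open>0 < B\<close> by (simp add: abs_mult)
      ultimately have "B / 2 * \<bar>q\<bar> \<le> (\<bar>A\<bar> + B / 2) * \<bar>p\<bar>" by (simp add: algebra_simps)
      hence "\<bar>q\<bar> \<le> 2 / B * ((\<bar>A\<bar> + B / 2) * \<bar>p\<bar>)" using \<open>0 < B\<close> by (simp add: field_simps)
      hence "\<bar>p\<bar> + \<bar>q\<bar> \<le> M * \<bar>p\<bar>" by (simp only: M_def distrib_right mult.assoc mult_1)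
      hence "e' * (\<bar>p\<bar> + \<bar>q\<bar>) \<le> e' * (M * \<bar>p\<bar>)" using \<open>0 < e'\<close> by (intro mult_left_mono) auto
      also have "\<dots> \<le> e * B * \<bar>p\<bar>" using \<open>e' * M \<le> e * B\<close>
        by (metis abs_ge_zero mult.assoc mult_right_mono)
      finally have "\<bar>A * p + B * q\<bar> \<le> B * (e * \<bar>p\<bar>)" using * by (simp add: mult.commute mult.left_commute)
      moreover have "A * p + B * q = B * (q - (- A / B) * p)" using \<open>0 < B\<close> by (simp add: field_simps)
      ultimately have "B * \<bar>q - (- A / B) * p\<bar> \<le> B * (e * \<bar>p\<bar>)" using \<open>0 < B\<close> by (simp only: abs_mult abs_of_pos)
      thus ?thesis using \<open>0 < B\<close> by (simp add: p_def q_def)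
    qed
    thus ?thesis using \<open>0 < d'\<close> by blast
  qed
  show ?thesis
    unfolding has_field_derivative_def has_derivative_at_alt
    using main bounded_linear_mult_right by blast
qed

lemma strict_mono_surj_inverse:
  fixes a :: "real \<Rightarrow> real"
  assumes "strict_mono a" "surj a"
  shows "strict_mono (inv a)" and "continuous_on UNIV (inv a)"
proof -
  show mono: "strict_mono (inv a)"
    using assms by (intro strict_monoI) (metis strict_mono_less surj_f_inv_f)
  have "surj (inv a)" using strict_mono_imp_inj_on[OF assms(1)] by (rule inj_imp_surj_inv)
  thus "continuous_on UNIV (inv a)"
    by (intro continuous_onI_mono) (auto simp: strict_mono_mono[OF mono, THEN monoD])
qed

text \<open>
  All three conclusions come from \<open>u \<ge> \<gamma> y / 2\<close>, which passes to the limit on the surface and inside \<open>D\<close>.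
  At the bottom it leaves only \<open>u \<ge> 0\<close>; as the bottom is a streamline, \<open>u = 0\<close> there is a stagnation point.
\<close>

lemma limit_of_family:
  assumes \<gamma>: "gamma_star < \<gamma>"
    and W: "W = stokes_wave \<or> W = solitary_wave"
    and fam: "unidirectional_family W \<gamma> T \<eta> \<psi> r"
    and wave: "general_wave \<gamma> D c \<phi> \<rho>"
    and forms: "forms_along T \<eta> \<psi> D c \<phi>"
  shows "\<not> extreme D c \<phi>" and "differentiable_graph c"
    and "general_unidirectional D \<phi> \<or> bottom_stagnation D \<phi>"
proof -
  let ?V = "velocity (closure D) \<phi>"
  have "0 < \<gamma>" using \<gamma> by (rule above_gamma_star)
  from forms[unfolded forms_along_def] obtain \<tau> \<xi> where \<tau>_all: "\<forall>n::nat. \<tau> n \<in> {0..<T}"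
    and \<xi>_all: "\<forall>n. continuous_on UNIV (\<xi> n) \<and> strict_mono (\<xi> n) \<and> surj (\<xi> n)"
    and surf_all: "\<forall>\<sigma>. (\<lambda>n. (\<xi> n \<sigma>, \<eta> (\<tau> n) (\<xi> n \<sigma>))) \<longlonglongrightarrow> c \<sigma>"
    and vel_all: "\<forall>\<sigma>. (\<lambda>n. velocity (closed_fluid (\<eta> (\<tau> n))) (\<psi> (\<tau> n)) (\<xi> n \<sigma>, \<eta> (\<tau> n) (\<xi> n \<sigma>)))
               \<longlonglongrightarrow> ?V (c \<sigma>)"
    and inside_all: "\<forall>z\<in>D. (\<forall>\<^sub>F n in sequentially. z \<in> fluid (\<eta> (\<tau> n))) \<and>
        (\<lambda>n. velocity (closed_fluid (\<eta> (\<tau> n))) (\<psi> (\<tau> n)) z) \<longlonglongrightarrow> ?V z"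
    by (elim exE conjE) (rule that)
  note \<tau> = \<tau>_all[rule_format] and surf = surf_all[rule_format] and vel = vel_all[rule_format]
    and \<xi> = \<xi>_all[rule_format, THEN conjunct2, THEN conjunct1]
    and inside = inside_all[rule_format, THEN conjunct1]
    and vel_inside = inside_all[rule_format, THEN conjunct2]
  have cont_c: "continuous_on UNIV c" and inj_c: "inj c" and c_pos_all: "\<forall>\<sigma>. 0 < snd (c \<sigma>)"
    and c_top: "filterlim (\<lambda>\<sigma>. fst (c \<sigma>)) at_top at_top"
    and c_bot: "filterlim (\<lambda>\<sigma>. fst (c \<sigma>)) at_bot at_bot"
    and "open D" and D_pos: "D \<subseteq> {(x, y). 0 < y}"
    and frontier: "frontier D = {(x, y). y = 0} \<union> range c"
    and \<phi>_all: "\<forall>z\<in>closure D. \<phi> differentiable (at z within closure D)"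
    and cont_V: "continuous_on (closure D) ?V"
    and \<phi>_surface_all: "\<forall>z\<in>range c. \<phi> z = 1" and \<phi>_bottom_all: "\<forall>x. \<phi> (x, 0) = 0"
    using wave[unfolded general_wave_def] by - (elim conjE, assumption)+
  note c_pos = c_pos_all[rule_format] and \<phi> = \<phi>_all[rule_format]
    and \<phi>_surface = \<phi>_surface_all[rule_format, OF rangeI] and \<phi>_bottom = \<phi>_bottom_all[rule_format]
  note bound = family_estimates[OF \<gamma> W fam \<tau>]
  have lim_\<xi>: "(\<lambda>n. \<xi> n \<sigma>) \<longlonglongrightarrow> fst (c \<sigma>)" for \<sigma> using tendsto_fst[OF surf[of \<sigma>]] by simp
  have lim_\<eta>: "(\<lambda>n. \<eta> (\<tau> n) (\<xi> n \<sigma>)) \<longlonglongrightarrow> snd (c \<sigma>)" for \<sigma> using tendsto_snd[OF surf[of \<sigma>]] by simp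

  have u_ge_surface: "\<gamma> / 2 * snd (c \<sigma>) \<le> fst (?V (c \<sigma>))" for \<sigma>
  proof (rule LIMSEQ_le[OF tendsto_mult_left[OF lim_\<eta>] tendsto_fst[OF vel]])
    show "\<exists>N. \<forall>n\<ge>N. \<gamma> / 2 * \<eta> (\<tau> n) (\<xi> n \<sigma>)
        \<le> fst (velocity (closed_fluid (\<eta> (\<tau> n))) (\<psi> (\<tau> n)) (\<xi> n \<sigma>, \<eta> (\<tau> n) (\<xi> n \<sigma>)))"
      using bound(1)[OF bound(2)] by simp
  qed
  have u_surface: "0 < fst (?V (c \<sigma>))" for \<sigma>
  proof -
    have "0 < \<gamma> / 2 * snd (c \<sigma>)" using \<open>0 < \<gamma>\<close> c_pos[of \<sigma>] by simp
    thus ?thesis using u_ge_surface[of \<sigma>] by linarith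
  qed
  show "\<not> extreme D c \<phi>"
  proof
    assume "extreme D c \<phi>"
    then obtain \<sigma> where "?V (c \<sigma>) = (0, 0)" unfolding extreme_def by (elim bexE rangeE) simp
    thus False using u_surface[of \<sigma>] by simp
  qed

  have V_surface_closure: "c \<sigma> \<in> closure D" for \<sigma> using frontier by (auto simp: frontier_def)
  have bottom_closure: "(x, 0) \<in> closure D" for x using frontier by (auto simp: frontier_def)
  have grad: "(\<phi> has_derivative (\<lambda>(p, q). - snd (?V z) * p + fst (?V z) * q)) (at z within closure D)"
    if "z \<in> closure D" for z
    unfolding velocity_def pdx_def pdy_def fst_conv snd_conv minus_minus
    by (rule has_derivative_pair_coefficients[OF \<phi>[OF that, unfolded frechet_derivative_works]])

  show "differentiable_graph c"
  proof -
    define a where "a = (\<lambda>\<sigma>. fst (c \<sigma>))"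
    (* the approximating surfaces are graphs, so the abscissa is nondecreasing in the limit *)
    have "mono a"
    proof (rule monoI)
      fix \<sigma>1 \<sigma>2 :: real assume "\<sigma>1 \<le> \<sigma>2"
      thus "a \<sigma>1 \<le> a \<sigma>2" unfolding a_def
        by (intro LIMSEQ_le[OF lim_\<xi> lim_\<xi>]) (auto simp: strict_mono_less_eq[OF \<xi>])
    qed
    define R where "R = ((fst (?V (c 0)))\<^sup>2 + (snd (?V (c 0)))\<^sup>2) / 2 + snd (c 0)"
    have "(\<lambda>n. ((fst (velocity (closed_fluid (\<eta> (\<tau> n))) (\<psi> (\<tau> n)) (\<xi> n 0, \<eta> (\<tau> n) (\<xi> n 0))))\<^sup>2
        + (snd (velocity (closed_fluid (\<eta> (\<tau> n))) (\<psi> (\<tau> n)) (\<xi> n 0, \<eta> (\<tau> n) (\<xi> n 0))))\<^sup>2) / 2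
        + \<eta> (\<tau> n) (\<xi> n 0)) \<longlonglongrightarrow> R"
      unfolding R_def by (intro tendsto_intros vel lim_\<eta>) auto
    hence lim_r: "(\<lambda>n. r (\<tau> n)) \<longlonglongrightarrow> R" unfolding bound(3) .
    (* two parameters with the same abscissa have, by the uniform Lipschitz bound, the same height *)
    have "inj a"
    proof (rule injI)
      fix \<sigma>1 \<sigma>2 assume eq: "a \<sigma>1 = a \<sigma>2"
      have "\<bar>(snd (c \<sigma>1))\<^sup>2 - (snd (c \<sigma>2))\<^sup>2\<bar> \<le> 4 / \<gamma> * sqrt (2 * R) * \<bar>a \<sigma>1 - a \<sigma>2\<bar>"
      proof (rule LIMSEQ_le)
        show "(\<lambda>n. \<bar>(\<eta> (\<tau> n) (\<xi> n \<sigma>1))\<^sup>2 - (\<eta> (\<tau> n) (\<xi> n \<sigma>2))\<^sup>2\<bar>)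
            \<longlonglongrightarrow> \<bar>(snd (c \<sigma>1))\<^sup>2 - (snd (c \<sigma>2))\<^sup>2\<bar>"
          by (intro tendsto_intros lim_\<eta>)
        show "(\<lambda>n. 4 / \<gamma> * sqrt (2 * r (\<tau> n)) * \<bar>\<xi> n \<sigma>1 - \<xi> n \<sigma>2\<bar>)
            \<longlonglongrightarrow> 4 / \<gamma> * sqrt (2 * R) * \<bar>a \<sigma>1 - a \<sigma>2\<bar>"
          unfolding a_def by (intro tendsto_intros lim_\<xi> lim_r)
        show "\<exists>N. \<forall>n\<ge>N. \<bar>(\<eta> (\<tau> n) (\<xi> n \<sigma>1))\<^sup>2 - (\<eta> (\<tau> n) (\<xi> n \<sigma>2))\<^sup>2\<bar>
            \<le> 4 / \<gamma> * sqrt (2 * r (\<tau> n)) * \<bar>\<xi> n \<sigma>1 - \<xi> n \<sigma>2\<bar>"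
          using bound(4) by blast
      qed
      hence "(snd (c \<sigma>1))\<^sup>2 = (snd (c \<sigma>2))\<^sup>2" using eq by simp
      hence "snd (c \<sigma>1) = snd (c \<sigma>2)" using c_pos[of \<sigma>1] c_pos[of \<sigma>2] by (simp add: power2_eq_iff_nonneg)
      hence "c \<sigma>1 = c \<sigma>2" using eq by (simp add: a_def prod_eq_iff)
      thus "\<sigma>1 = \<sigma>2" using inj_c by (simp add: inj_eq)
    qed
    with \<open>mono a\<close> have a_mono: "strict_mono a"
      by (auto simp: strict_mono_def mono_def inj_def less_le)
    have cont_a: "continuous_on A a" for A
      unfolding a_def by (intro continuous_on_fst continuous_on_subset[OF cont_c]) auto
    have "surj a" unfolding surj_def
    proof
      fix x
      from c_top obtain m where m: "x \<le> a m"
        unfolding filterlim_at_top a_def by (metis eventually_at_top_linorder order_refl)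
      from c_bot obtain l where l: "a l \<le> x"
        unfolding filterlim_at_bot a_def by (metis eventually_at_bot_linorder order_refl)
      show "\<exists>\<sigma>. x = a \<sigma>"
      proof (cases "l \<le> m")
        case True
        thus ?thesis using IVT'[OF l m True cont_a] by auto
      next
        case False
        hence "a m \<le> a l" using \<open>mono a\<close> by (auto simp: mono_def)
        hence "x = a m" using l m by linarith
        thus ?thesis by blast
      qed
    qed
    define h where "h = (\<lambda>x. snd (c (inv a x)))"
    have graph: "c (inv a x) = (x, h x)" for x
      using surj_f_inv_f[OF \<open>surj a\<close>, of x] by (simp add: h_def a_def prod_eq_iff)
    have cont_h: "continuous_on UNIV h"
      unfolding h_def
      by (intro continuous_on_snd continuous_on_compose2[OF cont_c]
          strict_mono_surj_inverse(2)[OF a_mono \<open>surj a\<close>]) auto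
    have "h differentiable (at x)" for x
    proof -
      let ?z = "c (inv a x)"
      have "(h has_real_derivative - (- snd (?V ?z)) / fst (?V ?z)) (at x)"
      proof (rule level_curve_has_derivative)
        show "(\<phi> has_derivative (\<lambda>(p, q). - snd (?V ?z) * p + fst (?V ?z) * q)) (at (x, h x) within closure D)"
          using grad[OF V_surface_closure[of "inv a x"]] unfolding graph .
        show "isCont h x" using cont_h by (simp add: continuous_on_eq_continuous_at)
        show "(y, h y) \<in> closure D" for y using V_surface_closure[of "inv a y"] by (simp add: graph)
        show "\<phi> (y, h y) = 1" for y using \<phi>_surface[of "inv a y"] by (simp add: graph)
      qed (rule u_surface)
      thus ?thesis unfolding real_differentiable_def by blast
    qed
    moreover have "range c = range (\<lambda>x. (x, h x))"
    proof -
      have "range c = range (\<lambda>x. c (inv a x))"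
        using inj_imp_surj_inv[OF strict_mono_imp_inj_on[OF a_mono]] by (metis image_image)
      thus ?thesis by (simp add: graph)
    qed
    ultimately show ?thesis unfolding differentiable_graph_def by blast
  qed

  show "general_unidirectional D \<phi> \<or> bottom_stagnation D \<phi>"
  proof (rule disjCI)
    assume no_stag: "\<not> bottom_stagnation D \<phi>"
    have u_inside: "\<gamma> / 2 * snd z \<le> fst (?V z)" if "z \<in> D" for z
    proof (rule tendsto_lowerbound[OF tendsto_fst[OF vel_inside[OF that]]])
      show "\<forall>\<^sub>F n in sequentially. \<gamma> / 2 * snd z \<le> fst (velocity (closed_fluid (\<eta> (\<tau> n))) (\<psi> (\<tau> n)) z)"
        using inside[OF that]
      proof eventually_elim
        case (elim n)
        hence "z \<in> closed_fluid (\<eta> (\<tau> n))" by (auto simp: fluid_def closed_fluid_def)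
        thus ?case by (rule bound(1))
      qed
    qed simp
    have u_pos_inside: "0 < fst (?V z)" if "z \<in> D" for z
    proof -
      have "0 < snd z" using D_pos that by auto
      hence "0 < \<gamma> / 2 * snd z" using \<open>0 < \<gamma>\<close> by simp
      thus ?thesis using u_inside[OF that] by linarith
    qed
    have "0 < fst (?V (x, 0))" for x
    proof -
      have "((\<lambda>t. \<phi> (t, 0)) has_real_derivative - snd (?V (x, 0)) * 1 + fst (?V (x, 0)) * 0) (at x)"
        by (rule has_real_derivative_along[where p = "\<lambda>t. t" and q = "\<lambda>_. 0",
            OF grad[OF bottom_closure] DERIV_ident DERIV_const bottom_closure])
      from DERIV_unique[OF this[unfolded \<phi>_bottom] DERIV_const]
      have "snd (?V (x, 0)) = 0" by simp
      moreover have "?V (x, 0) \<noteq> (0, 0)" using no_stag unfolding bottom_stagnation_def by blast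
      moreover have "0 \<le> fst (?V (x, 0))"
        by (rule continuous_ge_on_closure[OF continuous_on_fst[OF cont_V] bottom_closure])
           (use u_pos_inside in \<open>auto intro: less_imp_le\<close>)
      ultimately show ?thesis by (simp add: prod_eq_iff less_le)
    qed
    moreover have "closure D = D \<union> frontier D" using \<open>open D\<close> by (simp add: closure_Un_frontier)
    ultimately show "general_unidirectional D \<phi>"
      unfolding general_unidirectional_def using u_pos_inside u_surface unfolding frontier
      by (auto simp del: split_paired_All)
  qed
qed

theorem theorem1:
  fixes \<gamma> T :: real
    and \<eta> :: "real \<Rightarrow> real \<Rightarrow> real"
    and \<psi> :: "real \<Rightarrow> real \<times> real \<Rightarrow> real"
    and r :: "real \<Rightarrow> real"
  assumes "gamma_star < \<gamma>"
    and "unidirectional_family stokes_wave \<gamma> T \<eta> \<psi> r \<or>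
         unidirectional_family solitary_wave \<gamma> T \<eta> \<psi> r"
  shows "(\<forall>t\<in>{0..<T}. \<forall>x.
            fst (velocity (closed_fluid (\<eta> t)) (\<psi> t) (x, \<eta> t x)) \<ge> 1 / 2 * \<gamma> * \<eta> t x) \<and>
         (\<forall>D c \<phi> \<rho>. general_wave \<gamma> D c \<phi> \<rho> \<longrightarrow> forms_along T \<eta> \<psi> D c \<phi> \<longrightarrow>
            \<not> extreme D c \<phi> \<and> differentiable_graph c \<and>
            (general_unidirectional D \<phi> \<or> bottom_stagnation D \<phi>))"
proof -
  obtain W where W: "W = stokes_wave \<or> W = solitary_wave"
    and fam: "unidirectional_family W \<gamma> T \<eta> \<psi> r"
    using assms(2) by blast
  have "1 / 2 * \<gamma> * \<eta> t x \<le> fst (velocity (closed_fluid (\<eta> t)) (\<psi> t) (x, \<eta> t x))"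
    if "t \<in> {0..<T}" for t x
    using family_estimates(1)[OF assms(1) W fam that family_estimates(2)[OF assms(1) W fam that], of x]
    by simp
  moreover have "\<not> extreme D c \<phi> \<and> differentiable_graph c \<and>
      (general_unidirectional D \<phi> \<or> bottom_stagnation D \<phi>)"
    if "general_wave \<gamma> D c \<phi> \<rho>" "forms_along T \<eta> \<psi> D c \<phi>" for D c \<phi> \<rho>
    using limit_of_family[OF assms(1) W fam that] by blast
  ultimately show ?thesis by blast
qed

end
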